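(* Let $S$ be a finite set with $q\ge2$ elements, $X=S^{\mathbb N}$ with shift $T$. Let $(\omega_n)_{n\ge0}$ be a stationary ergodic sequence of real random variables with $\sup_n\|\omega_n\|_\infty<\infty$, and let $f:X\to\mathbb R$ be of bounded variation, i.e. $\sum_{n\ge1}\mathrm{var}_n(f)<\infty$. For a realization $\omega=(\omega_n)$ put $$Z_n(\lambda,\omega)=\int_X\exp\Big(\lambda\sum_{k=0}^{n-1}\omega_kf(T^kx)\Big)\,d\sigma(x).$$ Then: (a) Almost surely the following two properties hold: (H1) for every $\lambda\in\mathbb R$ the limit $\phi(\lambda)=\lim_{n\to\infty}\frac1n\log Z_n(\lambda,\omega)$ exists; (H2) $$\sup_{N\ge1}\ \sup_{x_0=y_0,\dots,x_{N-1}=y_{N-1}}\ \sum_{k=0}^{N-1}|\omega_kf(T^kx)-\omega_kf(T^ky)|<\infty;$$ moreover the function $\phi$ is independent of $\omega$ (there is a deterministic function equal to $\phi$ almost surely). (b) If furthermore $f$ depends only on a finite number of coordinates, then $\phi$ is a real-analytic function of $\lambda\in\mathbb R$.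
   Context: Points of $X$ are sequences $x=(x_n)_{n\ge0}$ and $(Tx)_n=x_{n+1}$. $\sigma$ is the uniform Bernoulli measure on $X$, giving mass $q^{-n}$ to each cylinder $\{y:y_k=x_k,\ 0\le k<n\}$. For $f:X\to\mathbb R$ and $n\ge1$, $\mathrm{var}_n(f)=\sup\{|f(x)-f(y)|: x_0=y_0,\dots,x_{n-1}=y_{n-1}\}$. *)

theory Defs
  imports "HOL-Probability.Probability"
begin

definition left_shift :: "(nat \<Rightarrow> 'a) \<Rightarrow> nat \<Rightarrow> 'a" where
  "left_shift x = (\<lambda>n. x (Suc n))"

definition seqs :: "'s set \<Rightarrow> (nat \<Rightarrow> 's) set" where
  "seqs S = {x. \<forall>n. x n \<in> S}"

definition bernoulli :: "'s set \<Rightarrow> (nat \<Rightarrow> 's) measure" where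
  "bernoulli S = (\<Pi>\<^sub>M n\<in>UNIV. uniform_count_measure S)"

lemma space_bernoulli: "space (bernoulli S) = seqs S"
  by (auto simp: bernoulli_def seqs_def space_PiM space_uniform_count_measure PiE_def Pi_def)

text \<open>The product measure gives mass $q^{-n}$ to each cylinder of length $n$.\<close>

lemma emeasure_bernoulli_cylinder:
  assumes "finite S" "S \<noteq> {}" "x \<in> seqs S"
  shows "emeasure (bernoulli S) {y \<in> seqs S. \<forall>k<n. y k = x k} = ennreal (1 / real (card S) ^ n)"
proof -
  interpret U: prob_space "uniform_count_measure S"
    using assms by (intro prob_space_uniform_count_measure) auto
  interpret P: product_prob_space "\<lambda>_::nat. uniform_count_measure S" UNIV
    by unfold_locales
  have "{y \<in> seqs S. \<forall>k<n. y k = x k} =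
      {y \<in> space (bernoulli S). \<forall>k\<in>{..<n}. y k \<in> {x k}}"
    by (auto simp: space_bernoulli)
  then have "emeasure (bernoulli S) {y \<in> seqs S. \<forall>k<n. y k = x k} =
      (\<Prod>k<n. emeasure (uniform_count_measure S) {x k})"
    using assms unfolding bernoulli_def
    by (simp only:) (rule P.emeasure_PiM_Collect; auto simp: sets_uniform_count_measure seqs_def)
  also have "\<dots> = (\<Prod>k<n. ennreal (1 / real (card S)))"
    using assms by (intro prod.cong) (auto simp: emeasure_uniform_count_measure seqs_def)
  also have "\<dots> = ennreal (1 / real (card S) ^ n)"
    by (simp add: ennreal_power power_one_over)
  finally show ?thesis .
qed

definition agreeing :: "'s set \<Rightarrow> nat \<Rightarrow> ((nat \<Rightarrow> 's) \<times> (nat \<Rightarrow> 's)) set" where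
  "agreeing S n = {(x, y). x \<in> seqs S \<and> y \<in> seqs S \<and> (\<forall>k<n. x k = y k)}"

text \<open>Suprema and sums are taken in \<open>ennreal\<close>, since they are not known to be finite a priori.\<close>

definition var :: "'s set \<Rightarrow> nat \<Rightarrow> ((nat \<Rightarrow> 's) \<Rightarrow> real) \<Rightarrow> ennreal" where
  "var S n f = (SUP (x, y)\<in>agreeing S n. ennreal \<bar>f x - f y\<bar>)"

definition bounded_variation :: "'s set \<Rightarrow> ((nat \<Rightarrow> 's) \<Rightarrow> real) \<Rightarrow> bool" where
  "bounded_variation S f \<longleftrightarrow> (\<Sum>n. var S (Suc n) f) < \<infinity>"

definition depends_on_finitely_many_coords :: "'s set \<Rightarrow> ((nat \<Rightarrow> 's) \<Rightarrow> real) \<Rightarrow> bool" where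
  "depends_on_finitely_many_coords S f \<longleftrightarrow>
     (\<exists>J. finite J \<and> (\<forall>x\<in>seqs S. \<forall>y\<in>seqs S. (\<forall>k\<in>J. x k = y k) \<longrightarrow> f x = f y))"

definition process_law :: "'w measure \<Rightarrow> (nat \<Rightarrow> 'w \<Rightarrow> real) \<Rightarrow> (nat \<Rightarrow> real) measure" where
  "process_law M \<omega> = distr M (\<Pi>\<^sub>M n\<in>UNIV. borel) (\<lambda>w n. \<omega> n w)"

definition stationary :: "'w measure \<Rightarrow> (nat \<Rightarrow> 'w \<Rightarrow> real) \<Rightarrow> bool" where
  "stationary M \<omega> \<longleftrightarrow> process_law M (\<lambda>n. \<omega> (Suc n)) = process_law M \<omega>"

definition ergodic :: "'w measure \<Rightarrow> (nat \<Rightarrow> 'w \<Rightarrow> real) \<Rightarrow> bool" where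
  "ergodic M \<omega> \<longleftrightarrow>
     (\<forall>A\<in>sets (\<Pi>\<^sub>M n\<in>UNIV. borel). left_shift -` A = A \<longrightarrow>
        measure (process_law M \<omega>) A = 0 \<or> measure (process_law M \<omega>) A = 1)"

text \<open>Here \<open>w\<close> is a single realization, i.e. a sequence of real weights.\<close>

definition partition_fn ::
    "'s set \<Rightarrow> ((nat \<Rightarrow> 's) \<Rightarrow> real) \<Rightarrow> nat \<Rightarrow> real \<Rightarrow> (nat \<Rightarrow> real) \<Rightarrow> real" where
  "partition_fn S f n lam w =
     (\<integral>x. exp (lam * (\<Sum>k<n. w k * f ((left_shift ^^ k) x))) \<partial>bernoulli S)"

definition H1 :: "'s set \<Rightarrow> ((nat \<Rightarrow> 's) \<Rightarrow> real) \<Rightarrow> (nat \<Rightarrow> real) \<Rightarrow> bool" where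
  "H1 S f w \<longleftrightarrow> (\<forall>lam. convergent (\<lambda>n. 1 / real n * ln (partition_fn S f n lam w)))"

definition pressure :: "'s set \<Rightarrow> ((nat \<Rightarrow> 's) \<Rightarrow> real) \<Rightarrow> (nat \<Rightarrow> real) \<Rightarrow> real \<Rightarrow> real" where
  "pressure S f w lam = lim (\<lambda>n. 1 / real n * ln (partition_fn S f n lam w))"

definition H2 :: "'s set \<Rightarrow> ((nat \<Rightarrow> 's) \<Rightarrow> real) \<Rightarrow> (nat \<Rightarrow> real) \<Rightarrow> bool" where
  "H2 S f w \<longleftrightarrow>
     (SUP N\<in>{1..}. SUP (x, y)\<in>agreeing S N.
        ennreal (\<Sum>k<N. \<bar>w k * f ((left_shift ^^ k) x) - w k * f ((left_shift ^^ k) y)\<bar>)) < \<infinity>"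

text \<open>Near each point the function is given by a power series with positive radius of convergence.\<close>

definition real_analytic_on :: "(real \<Rightarrow> real) \<Rightarrow> real set \<Rightarrow> bool" where
  "real_analytic_on g A \<longleftrightarrow> (\<forall>a\<in>A. \<exists>F. (\<lambda>h. g (a + h)) has_fps_expansion F)"

end

theory Submission
  imports Defs "HOL-Complex_Analysis.Complex_Analysis"
begin

text \<open>
  Because \<open>f\<close> has bounded variation, the energy of a block of coordinates is determined by the block up to
  a bounded error. Since distinct blocks are independent under the Bernoulli measure, \<open>log Z\<^sub>n\<close> is
  almost additive along the shift of the weights. Hence \<open>m log Z\<^sub>n\<close> is, up to \<open>O(n)\<close> with a constant
  independent of \<open>m\<close>, a Birkhoff sum of \<open>log Z\<^sub>m\<close>. Birkhoff's theorem for all \<open>m\<close> and all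
  rational \<open>\<lambda>\<close> gives a deterministic limit, and the Lipschitz dependence on \<open>\<lambda>\<close> extends it to all real \<open>\<lambda>\<close>.

  If \<open>f\<close> depends on the first \<open>d\<close> coordinates, \<open>Z\<^sub>m\<^sub>d\<close> is a product of \<open>m\<close> positive matrices whose
  entries are bounded above and away from zero uniformly in the weights. Rugh's complex cone of vectors with
  pairwise acute entries is invariant under such matrices and under their perturbations to complex \<open>\<lambda>\<close>
  in a disc not depending on \<open>m\<close>. The partition functions therefore have no zeros in that disc, and
  Montel's theorem applied to their \<open>m\<close>-th roots gives a holomorphic limit of modulus \<open>exp (d (\<phi> + log q))\<close> on
  the real axis.
\<close>

section \<open>Birkhoff's ergodic theorem\<close>

definition birkhoff_sum :: "('a \<Rightarrow> 'a) \<Rightarrow> ('a \<Rightarrow> real) \<Rightarrow> nat \<Rightarrow> 'a \<Rightarrow> real" where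
  "birkhoff_sum T g n x = (\<Sum>k<n. g ((T ^^ k) x))"

lemma birkhoff_sum_0 [simp]: "birkhoff_sum T g 0 x = 0"
  by (simp add: birkhoff_sum_def)

lemma birkhoff_sum_Suc: "birkhoff_sum T g (Suc n) x = g x + birkhoff_sum T g n (T x)"
  unfolding birkhoff_sum_def sum.lessThan_Suc_shift by (simp add: funpow_swap1)

lemma birkhoff_sum_diff_const:
  "birkhoff_sum T (\<lambda>x. g x - c) n x = birkhoff_sum T g n x - c * real n"
  by (simp add: birkhoff_sum_def sum_subtractf)

lemma birkhoff_sum_uminus: "birkhoff_sum T (\<lambda>x. - g x) n x = - birkhoff_sum T g n x"
  by (simp add: birkhoff_sum_def sum_negf)

lemma birkhoff_sum_measurable:
  assumes [measurable]: "T \<in> measurable M M" "g \<in> borel_measurable M"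
  shows "birkhoff_sum T g n \<in> borel_measurable M"
  unfolding birkhoff_sum_def[abs_def] by measurable

text \<open>The running maximum of the Birkhoff sums of length at most \<open>n\<close>.\<close>

primrec birkhoff_max :: "('a \<Rightarrow> 'a) \<Rightarrow> ('a \<Rightarrow> real) \<Rightarrow> nat \<Rightarrow> 'a \<Rightarrow> real" where
  "birkhoff_max T g 0 x = 0"
| "birkhoff_max T g (Suc n) x = max 0 (g x + birkhoff_max T g n (T x))"

lemma birkhoff_max_nonneg: "0 \<le> birkhoff_max T g n x"
  by (cases n) auto

lemma birkhoff_max_le_Suc: "birkhoff_max T g n x \<le> birkhoff_max T g (Suc n) x"
proof (induction n arbitrary: x)
  case (Suc n)
  show ?case using Suc.IH[of "T x"] by simp
qed simp

lemma birkhoff_max_mono: "m \<le> n \<Longrightarrow> birkhoff_max T g m x \<le> birkhoff_max T g n x"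
  by (rule lift_Suc_mono_le[of "\<lambda>n. birkhoff_max T g n x", OF birkhoff_max_le_Suc])

lemma birkhoff_sum_le_max: "birkhoff_sum T g n x \<le> birkhoff_max T g n x"
proof (induction n arbitrary: x)
  case (Suc n)
  show ?case using Suc.IH[of "T x"] by (simp add: birkhoff_sum_Suc)
qed simp

lemma integrable_distr_self:
  fixes g :: "'a \<Rightarrow> real"
  assumes "T \<in> measurable M M" "distr M M T = M" "integrable M g"
  shows "integrable M (\<lambda>x. g (T x))"
  using integrable_distr[OF assms(1), of g] assms by simp

lemma birkhoff_max_integrable:
  assumes "T \<in> measurable M M" "distr M M T = M" "integrable M g"
  shows "integrable M (birkhoff_max T g n)"
proof (induction n)
  case 0
  show ?case by (simp add: birkhoff_max.simps[abs_def])
next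
  case (Suc n)
  have "integrable M (\<lambda>x. max 0 (g x + birkhoff_max T g n (T x)))"
    using Suc integrable_distr_self[OF assms(1,2)] assms(3)
    by (intro Bochner_Integration.integrable_max Bochner_Integration.integrable_add) auto
  then show ?case by (simp add: birkhoff_max.simps(2)[abs_def])
qed

text \<open>Garsia's argument for the maximal ergodic inequality: where the running maximum \<open>R\<close> is
  positive, \<open>g \<ge> R - R \<circ> T\<close>, and the right-hand side has integral zero.\<close>

lemma maximal_ergodic_inequality:
  assumes T [measurable]: "T \<in> measurable M M" and pres: "distr M M T = M" and g: "integrable M g"
  shows "0 \<le> (\<integral>x. (if 0 < birkhoff_max T g n x then g x else 0) \<partial>M)"
proof -
  let ?R = "birkhoff_max T g n"
  note iR = birkhoff_max_integrable[OF T pres g, of n]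
  note iRT = integrable_distr_self[OF T pres iR]
  have [measurable]: "?R \<in> borel_measurable M" "g \<in> borel_measurable M" using iR g by auto
  have "(\<integral>x. ?R (T x) \<partial>M) = (\<integral>x. ?R x \<partial>M)"
    using integral_distr[OF T, of ?R] pres by simp
  then have "0 = (\<integral>x. ?R x - ?R (T x) \<partial>M)" using iR iRT by simp
  also have "\<dots> \<le> (\<integral>x. (if 0 < ?R x then g x else 0) \<partial>M)"
  proof (rule integral_mono)
    show "integrable M (\<lambda>x. ?R x - ?R (T x))" using iR iRT by simp
    show "integrable M (\<lambda>x. if 0 < ?R x then g x else 0)"
      by (rule Bochner_Integration.integrable_bound[OF g]) auto
    fix x
    show "?R x - ?R (T x) \<le> (if 0 < ?R x then g x else 0)"
    proof (cases "0 < ?R x")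
      case True
      then obtain k where k: "n = Suc k" by (cases n) auto
      have "?R x = g x + birkhoff_max T g k (T x)" using True by (auto simp: k max_def split: if_splits)
      moreover have "birkhoff_max T g k (T x) \<le> ?R (T x)" unfolding k by (rule birkhoff_max_le_Suc)
      ultimately show ?thesis using True by simp
    next
      case False
      then have "?R x = 0" using birkhoff_max_nonneg[of T g n x] by simp
      then show ?thesis using birkhoff_max_nonneg[of T g n "T x"] by simp
    qed
  qed
  finally show ?thesis .
qed

text \<open>As \<open>n\<close> grows, the sets where \<open>birkhoff_max\<close> is positive
  increase to a set of full measure, so the maximal inequality passes to the limit by dominated
  convergence with majorant \<open>\<bar>g x\<bar>\<close>.\<close>

lemma integral_nonneg_if_birkhoff_sum_pos:
  assumes T [measurable]: "T \<in> measurable M M" and pres: "distr M M T = M" and g: "integrable M g"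
    and pos: "AE x in M. \<exists>n. 0 < birkhoff_sum T g n x"
  shows "0 \<le> (\<integral>x. g x \<partial>M)"
proof -
  have [measurable]: "\<And>n. birkhoff_max T g n \<in> borel_measurable M" "g \<in> borel_measurable M"
    using birkhoff_max_integrable[OF T pres g] g by auto
  have "(\<lambda>n. \<integral>x. (if 0 < birkhoff_max T g n x then g x else 0) \<partial>M) \<longlonglongrightarrow> (\<integral>x. g x \<partial>M)"
  proof (rule integral_dominated_convergence[where w = "\<lambda>x. \<bar>g x\<bar>"])
    show "AE x in M. (\<lambda>n. if 0 < birkhoff_max T g n x then g x else 0) \<longlonglongrightarrow> g x"
      using pos
    proof eventually_elim
      case (elim x)
      then obtain k where "0 < birkhoff_sum T g k x" by auto
      then have "0 < birkhoff_max T g n x" if "k \<le> n" for n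
        using birkhoff_sum_le_max[of T g k x] birkhoff_max_mono[OF that, of T g x] by linarith
      then show ?case
        by (intro tendsto_eventually eventually_sequentiallyI[of k]) auto
    qed
  qed (use g in auto)
  then show ?thesis
    by (rule LIMSEQ_le_const) (use maximal_ergodic_inequality[OF T pres g] in auto)
qed

text \<open>The set where the sums of \<open>g - c\<close> are unbounded above is invariant. If it
  had measure 1, the preceding lemma would give \<open>g - c\<close> a nonnegative integral,
  contradicting the choice of \<open>c\<close>; ergodicity therefore makes it null.\<close>

lemma birkhoff_sum_upper_bound:
  assumes M: "prob_space M"
    and T [measurable]: "T \<in> measurable M M" and pres: "distr M M T = M" and g: "integrable M g"
    and erg: "\<And>A. A \<in> sets M \<Longrightarrow> T -` A \<inter> space M = A \<Longrightarrow> measure M A = 0 \<or> measure M A = 1"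
    and c: "(\<integral>x. g x \<partial>M) < c"
  shows "AE x in M. \<exists>K. \<forall>n. birkhoff_sum T g n x \<le> K + c * real n"
proof -
  interpret prob_space M by fact
  have [measurable]: "g \<in> borel_measurable M" using g by auto
  note [measurable] = birkhoff_sum_measurable[OF T \<open>g \<in> borel_measurable M\<close>]
  let ?S = "birkhoff_sum T (\<lambda>x. g x - c)"
  have [measurable]: "?S n \<in> borel_measurable M" for n by (rule birkhoff_sum_measurable) auto
  define A where "A = {x \<in> space M. \<forall>K::nat. \<exists>n. real K < ?S n x}"
  have [measurable]: "A \<in> sets M" unfolding A_def by measurable
  have "T x \<in> A \<longleftrightarrow> x \<in> A" if x: "x \<in> space M" for x
  proof
    assume Tx: "T x \<in> A"
    have "\<exists>n. real K < ?S n x" for K :: nat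
    proof -
      obtain K' :: nat where K': "real K - (g x - c) < real K'" using reals_Archimedean2 by blast
      obtain n where "real K' < ?S n (T x)" using Tx by (auto simp: A_def)
      then have "real K < ?S (Suc n) x" using K' by (simp add: birkhoff_sum_Suc)
      then show ?thesis by blast
    qed
    then show "x \<in> A" using x by (simp add: A_def)
  next
    assume xA: "x \<in> A"
    have "\<exists>n. real K < ?S n (T x)" for K :: nat
    proof -
      obtain K' :: nat where K': "real K + \<bar>g x - c\<bar> < real K'" using reals_Archimedean2 by blast
      obtain n where n: "real K' < ?S n x" using xA by (auto simp: A_def)
      \<comment> \<open>The sum of length 0 is 0 and cannot exceed \<open>K'\<close>, so there is a
        first term to split off.\<close>
      then obtain m where "n = Suc m" by (cases n) auto
      then have "real K < ?S m (T x)" using K' n by (simp add: birkhoff_sum_Suc)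
      then show ?thesis by blast
    qed
    then show "T x \<in> A" using x measurable_space[OF T] by (simp add: A_def)
  qed
  then have inv: "T -` A \<inter> space M = A" by (auto simp: A_def)
  have "measure M A \<noteq> 1"
  proof
    assume "measure M A = 1"
    then have "AE x in M. x \<in> A" by (simp add: prob_eq_1)
    then have "AE x in M. \<exists>n. 0 < ?S n x"
      by eventually_elim (auto simp: A_def dest!: spec[of _ 0])
    from integral_nonneg_if_birkhoff_sum_pos[OF T pres _ this] g
    have "0 \<le> (\<integral>x. g x - c \<partial>M)" by simp
    then show False using c g by (simp add: prob_space)
  qed
  then have "measure M A = 0" using erg[OF _ inv] by auto
  then have "AE x in M. x \<notin> A" by (simp add: prob_eq_0)
  then show ?thesis
    using AE_space
  proof eventually_elim
    case (elim x)
    then obtain K :: nat where K: "\<And>n. ?S n x \<le> real K" by (auto simp: A_def not_less)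
    then show ?case using K by (intro exI[of _ "real K"]) (simp add: birkhoff_sum_diff_const algebra_simps)
  qed
qed

text \<open>One-sided bounds for \<open>g\<close> and \<open>- g\<close> with slack
  \<open>inverse (Suc j)\<close>, taken for all \<open>j\<close> at once, suffice: the additive
  constants disappear on division by \<open>n\<close>.\<close>

theorem birkhoff_ergodic:
  assumes M: "prob_space M"
    and T [measurable]: "T \<in> measurable M M" and pres: "distr M M T = M" and g: "integrable M g"
    and erg: "\<And>A. A \<in> sets M \<Longrightarrow> T -` A \<inter> space M = A \<Longrightarrow> measure M A = 0 \<or> measure M A = 1"
  shows "AE x in M. (\<lambda>n. birkhoff_sum T g n x / real n) \<longlonglongrightarrow> (\<integral>x. g x \<partial>M)"
proof -
  let ?I = "\<integral>x. g x \<partial>M"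
  let ?S = "birkhoff_sum T g"
  have up: "AE x in M. \<forall>j::nat. \<exists>K. \<forall>n. ?S n x \<le> K + (?I + inverse (Suc j)) * real n"
    unfolding AE_all_countable
    by (intro allI birkhoff_sum_upper_bound[OF M T pres g erg]) auto
  have ing: "integrable M (\<lambda>x. - g x)" using g by simp
  have lo: "AE x in M. \<forall>j::nat. \<exists>K. \<forall>n. - ?S n x \<le> K + (- ?I + inverse (Suc j)) * real n"
    unfolding AE_all_countable birkhoff_sum_uminus[symmetric]
    by (intro allI birkhoff_sum_upper_bound[OF M T pres ing erg]) auto
  show ?thesis
    using up lo
  proof eventually_elim
    case (elim x)
    show ?case
    proof (rule LIMSEQ_I)
      fix r :: real assume r: "0 < r"
      obtain j where j: "inverse (real (Suc j)) < r / 2" using reals_Archimedean[of "r/2"] r by auto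
      obtain K where K: "\<And>n. ?S n x \<le> K + (?I + inverse (Suc j)) * real n" using elim(1) by blast
      obtain L where L: "\<And>n. - ?S n x \<le> L + (- ?I + inverse (Suc j)) * real n" using elim(2) by blast
      define D where "D = max \<bar>K\<bar> \<bar>L\<bar>"
      have KD: "K \<le> D" "L \<le> D" by (auto simp: D_def)
      obtain N :: nat where N: "2 * D / r < real N" using reals_Archimedean2 by blast
      show "\<exists>no. \<forall>n\<ge>no. norm (?S n x / real n - ?I) < r"
      proof (intro exI allI impI)
        fix n assume n: "n \<ge> Suc N"
        have "2 * D / r < real n" using N n by simp
        then have Dn: "D < r / 2 * real n" using r by (simp add: field_simps)
        have jn: "inverse (Suc j) * real n < r / 2 * real n"
          using j n by (intro mult_strict_right_mono) auto
        have "\<bar>?S n x - ?I * real n\<bar> < r * real n"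
          using K[of n] L[of n] Dn jn KD by (simp add: algebra_simps abs_less_iff)
        moreover have "?S n x / real n - ?I = (?S n x - ?I * real n) / real n"
          using n by (simp add: field_simps)
        ultimately show "norm (?S n x / real n - ?I) < r"
          using n by (simp add: field_simps)
      qed
    qed
  qed
qed

section \<open>The Bernoulli measure\<close>

lemma funpow_left_shift: "(left_shift ^^ k) x = (\<lambda>n. x (n + k))"
  by (induction k) (auto simp: left_shift_def)

lemma left_shift_measurable:
  "left_shift \<in> measurable (\<Pi>\<^sub>M n\<in>UNIV. N) (\<Pi>\<^sub>M n\<in>UNIV. N)"
  unfolding left_shift_def[abs_def]
  by (intro measurable_PiM_single' measurable_component_singleton) (auto simp: space_PiM PiE_iff)

lemma seqs_funpow_left_shift: "x \<in> seqs S \<Longrightarrow> (left_shift ^^ k) x \<in> seqs S"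
  by (auto simp: seqs_def funpow_left_shift)

lemma seqs_comb_seq: "x \<in> seqs S \<Longrightarrow> y \<in> seqs S \<Longrightarrow> comb_seq n x y \<in> seqs S"
  by (auto simp: seqs_def comb_seq_def)

lemma left_shift_comb_seq: "(left_shift ^^ n) (comb_seq n x y) = y"
  by (auto simp: funpow_left_shift comb_seq_add)

definition energy :: "((nat \<Rightarrow> 's) \<Rightarrow> real) \<Rightarrow> (nat \<Rightarrow> real) \<Rightarrow> nat \<Rightarrow> (nat \<Rightarrow> 's) \<Rightarrow> real" where
  "energy f w n x = (\<Sum>k<n. w k * f ((left_shift ^^ k) x))"

lemma partition_fn_energy:
  "partition_fn S f n lam w = (\<integral>x. exp (lam * energy f w n x) \<partial>bernoulli S)"
  by (simp add: partition_fn_def energy_def)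

lemma energy_add:
  "energy f w (n + m) x = energy f w n x + energy f ((left_shift ^^ n) w) m ((left_shift ^^ n) x)"
proof (induction m)
  case (Suc m)
  have "(left_shift ^^ m) ((left_shift ^^ n) x) = (left_shift ^^ (n + m)) x"
    by (simp add: funpow_left_shift ac_simps)
  with Suc show ?case by (simp add: energy_def) (simp add: funpow_left_shift ac_simps)
qed (simp add: energy_def)

section \<open>Words, cylinders and independence of prefix and tail\<close>

locale finite_alphabet =
  fixes S :: "'s set"
  assumes finite_alphabet: "finite S" and alphabet_nonempty: "S \<noteq> {}"
begin

sublocale U: prob_space "uniform_count_measure S"
  using finite_alphabet alphabet_nonempty by (rule prob_space_uniform_count_measure)

sublocale SS: sequence_space "uniform_count_measure S"
  by unfold_locales

sublocale B: prob_space "bernoulli S"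
  unfolding bernoulli_def by (rule SS.prob_space_axioms)

sublocale BB: pair_sigma_finite "bernoulli S" "bernoulli S"
  by unfold_locales

definition symbol :: 's where "symbol = (SOME s. s \<in> S)"

lemma symbol_in: "symbol \<in> S"
  unfolding symbol_def using alphabet_nonempty by (simp add: some_in_eq)

text \<open>Words of length \<open>n\<close>, represented by the sequences that are constantly \<open>symbol\<close> from
  position \<open>n\<close> on.\<close>

definition pad :: "nat \<Rightarrow> (nat \<Rightarrow> 's) \<Rightarrow> nat \<Rightarrow> 's" where
  "pad n x = comb_seq n x (\<lambda>_. symbol)"

definition words :: "nat \<Rightarrow> (nat \<Rightarrow> 's) set" where
  "words n = pad n ` seqs S"

lemma pad_in_seqs: "x \<in> seqs S \<Longrightarrow> pad n x \<in> seqs S"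
  unfolding pad_def using symbol_in by (intro seqs_comb_seq) (auto simp: seqs_def)

lemma pad_less: "k < n \<Longrightarrow> pad n x k = x k"
  by (simp add: pad_def comb_seq_less)

lemma words_subset: "words n \<subseteq> seqs S"
  by (auto simp: words_def pad_in_seqs)

lemma pad_eq_iff: "pad n x = pad n y \<longleftrightarrow> (\<forall>k<n. x k = y k)"
proof
  assume "pad n x = pad n y"
  then show "\<forall>k<n. x k = y k" by (metis pad_less)
qed (auto simp: pad_def comb_seq_def)

lemma pad_words: "c \<in> words n \<Longrightarrow> pad n c = c"
  by (auto simp: words_def pad_eq_iff pad_less)

lemma finite_words: "finite (words n)"
proof -
  have "words n \<subseteq> (\<lambda>g k. if k < n then g k else symbol) ` (PiE {..<n} (\<lambda>_. S))"
  proof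
    fix c assume "c \<in> words n"
    then obtain x where x: "x \<in> seqs S" "c = pad n x" by (auto simp: words_def)
    show "c \<in> (\<lambda>g k. if k < n then g k else symbol) ` (PiE {..<n} (\<lambda>_. S))"
    proof (rule image_eqI)
      show "c = (\<lambda>k. if k < n then restrict x {..<n} k else symbol)"
        by (rule ext) (simp add: x(2) pad_def comb_seq_def)
      show "restrict x {..<n} \<in> PiE {..<n} (\<lambda>_. S)" using x(1) by (simp add: seqs_def)
    qed
  qed
  then show ?thesis
    by (rule finite_subset) (intro finite_imageI finite_PiE finite_lessThan finite_alphabet)
qed

lemma words_nonempty: "words n \<noteq> {}"
proof -
  have "pad n (\<lambda>_. symbol) \<in> words n"
    unfolding words_def by (rule imageI) (simp add: seqs_def, rule symbol_in)
  then show ?thesis by (metis empty_iff)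
qed

definition cylinder :: "nat \<Rightarrow> (nat \<Rightarrow> 's) \<Rightarrow> (nat \<Rightarrow> 's) set" where
  "cylinder n x = {y \<in> seqs S. \<forall>k<n. y k = x k}"

lemma emeasure_cylinder:
  assumes "x \<in> seqs S"
  shows "emeasure (bernoulli S) (cylinder n x) = ennreal (1 / real (card S) ^ n)"
  unfolding cylinder_def by (rule emeasure_bernoulli_cylinder[OF finite_alphabet alphabet_nonempty assms])

text \<open>Measurability is read off from the value of the measure: \<open>emeasure\<close> is 0 on
  nonmeasurable sets, whereas a cylinder has positive mass.\<close>

lemma cylinder_sets:
  assumes x: "x \<in> seqs S"
  shows "cylinder n x \<in> sets (bernoulli S)"
proof (rule ccontr)
  assume "cylinder n x \<notin> sets (bernoulli S)"
  then have "ennreal (1 / real (card S) ^ n) = 0"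
    unfolding emeasure_cylinder[OF x, of n, symmetric] by (rule emeasure_notin_sets)
  moreover have "0 < 1 / real (card S) ^ n"
    using finite_alphabet alphabet_nonempty by (simp add: card_gt_0_iff)
  ultimately show False using ennreal_eq_0_iff leD by blast
qed

lemma measure_cylinder: "x \<in> seqs S \<Longrightarrow> measure (bernoulli S) (cylinder n x) = 1 / real (card S) ^ n"
  using emeasure_cylinder[of x n] by (simp add: measure_def)

text \<open>\<open>pad n x\<close> is the only word whose cylinder contains \<open>x\<close>. The
  finite expansion reduces integrals of functions of \<open>n\<close> coordinates to measures of
  cylinders.\<close>

lemma cylinder_expansion:
  fixes h :: "_ \<Rightarrow> real"
  assumes x: "x \<in> seqs S"
  shows "h (pad n x) = (\<Sum>c\<in>words n. h c * indicator (cylinder n c) x)"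
proof -
  have *: "indicator (cylinder n c) x = (if c = pad n x then 1 else 0::real)"
    if "c \<in> words n" for c
    using x pad_words[OF that] pad_eq_iff[of n x c] by (auto simp: indicator_def cylinder_def)
  have "pad n x \<in> words n" using x by (simp add: words_def)
  then show ?thesis using finite_words by (simp add: * if_distrib cong: if_cong)
qed

lemma cylinder_term_integrable:
  fixes r :: real
  assumes "c \<in> words n"
  shows "integrable (bernoulli S) (\<lambda>x. r * indicator (cylinder n c) x)"
proof -
  have "cylinder n c \<in> sets (bernoulli S)" using words_subset assms by (intro cylinder_sets) blast
  then show ?thesis by (simp add: B.emeasure_finite less_top[symmetric])
qed

lemma integrable_cylinder_function:
  fixes h :: "_ \<Rightarrow> real"
  shows "integrable (bernoulli S) (\<lambda>x. h (pad n x))"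
proof -
  let ?g = "\<lambda>x. \<Sum>c\<in>words n. h c * indicator (cylinder n c) x"
  have "integrable (bernoulli S) ?g"
    by (rule Bochner_Integration.integrable_sum) (rule cylinder_term_integrable)
  moreover have "integrable (bernoulli S) (\<lambda>x. h (pad n x)) \<longleftrightarrow> integrable (bernoulli S) ?g"
    by (rule Bochner_Integration.integrable_cong)
      (rule refl, rule cylinder_expansion, simp add: space_bernoulli)
  ultimately show ?thesis by blast
qed

lemma integral_cylinder_function:
  fixes h :: "_ \<Rightarrow> real"
  shows "(\<integral>x. h (pad n x) \<partial>bernoulli S) = (\<Sum>c\<in>words n. h c) / real (card S) ^ n"
proof -
  have "(\<integral>x. h (pad n x) \<partial>bernoulli S) =
      (\<integral>x. (\<Sum>c\<in>words n. h c * indicator (cylinder n c) x) \<partial>bernoulli S)"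
    by (rule Bochner_Integration.integral_cong) (rule refl, rule cylinder_expansion, simp add: space_bernoulli)
  also have "\<dots> = (\<Sum>c\<in>words n. \<integral>x. h c * indicator (cylinder n c) x \<partial>bernoulli S)"
    by (rule Bochner_Integration.integral_sum) (rule cylinder_term_integrable)
  also have "\<dots> = (\<Sum>c\<in>words n. h c / real (card S) ^ n)"
  proof (intro sum.cong refl)
    fix c assume "c \<in> words n"
    then have c: "c \<in> seqs S" using words_subset by blast
    have "cylinder n c \<inter> space (bernoulli S) = cylinder n c"
      by (auto simp: space_bernoulli cylinder_def)
    then show "(\<integral>x. h c * indicator (cylinder n c) x \<partial>bernoulli S) = h c / real (card S) ^ n"
      using measure_cylinder[OF c, of n] by simp
  qed
  finally show ?thesis by (simp add: sum_divide_distrib)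
qed

lemma comb_seq_measurable [measurable]:
  "(\<lambda>p. comb_seq n (fst p) (snd p)) \<in> measurable (bernoulli S \<Otimes>\<^sub>M bernoulli S) (bernoulli S)"
  unfolding bernoulli_def by measurable

lemma funpow_left_shift_measurable [measurable]:
  "left_shift ^^ k \<in> measurable (bernoulli S) (bernoulli S)"
proof (induction k)
  case 0
  show ?case by (simp add: id_def)
next
  case (Suc k)
  have "left_shift \<in> measurable (bernoulli S) (bernoulli S)"
    unfolding bernoulli_def by (rule left_shift_measurable)
  from measurable_comp[OF Suc this] show ?case by (simp add: comp_def)
qed

text \<open>By \<open>PiM_comb_seq\<close>, the first \<open>n\<close> coordinates of one Bernoulli
  sequence followed by an independent second one again have the Bernoulli law.\<close>

lemma integral_comb_seq:
  fixes G :: "_ \<Rightarrow> real"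
  assumes G: "integrable (bernoulli S) G"
  shows "integrable (bernoulli S \<Otimes>\<^sub>M bernoulli S) (\<lambda>(x, y). G (comb_seq n x y))"
    and "(\<integral>x. (\<integral>y. G (comb_seq n x y) \<partial>bernoulli S) \<partial>bernoulli S) = (\<integral>x. G x \<partial>bernoulli S)"
proof -
  have D: "distr (bernoulli S \<Otimes>\<^sub>M bernoulli S) (bernoulli S) (\<lambda>p. comb_seq n (fst p) (snd p)) = bernoulli S"
    using SS.PiM_comb_seq[of n] by (simp add: bernoulli_def case_prod_unfold)
  show *: "integrable (bernoulli S \<Otimes>\<^sub>M bernoulli S) (\<lambda>(x, y). G (comb_seq n x y))"
    using integrable_distr[OF comb_seq_measurable, of n G] G by (simp add: D case_prod_unfold)
  show "(\<integral>x. (\<integral>y. G (comb_seq n x y) \<partial>bernoulli S) \<partial>bernoulli S) = (\<integral>x. G x \<partial>bernoulli S)"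
    using BB.integral_fst'[OF *] integral_distr[OF comb_seq_measurable, of G n] G
    by (simp add: D case_prod_unfold)
qed

text \<open>The inner integral over the tail depends only on the first \<open>n\<close> coordinates
  of the prefix, so the outer one is a finite mean over words. Each application peels one block of
  coordinates off a partition function.\<close>

lemma integral_split_word:
  fixes G :: "_ \<Rightarrow> real"
  assumes G: "integrable (bernoulli S) G"
  shows "(\<integral>x. G x \<partial>bernoulli S) =
    (\<Sum>c\<in>words n. \<integral>y. G (comb_seq n c y) \<partial>bernoulli S) / real (card S) ^ n"
proof -
  have "comb_seq n (pad n x) y = comb_seq n x y" for x y
    by (auto simp: comb_seq_def pad_def)
  then show ?thesis
    using integral_comb_seq(2)[OF G, of n]
      integral_cylinder_function[of "\<lambda>x. \<integral>y. G (comb_seq n x y) \<partial>bernoulli S" n] by simp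
qed

end

section \<open>Almost additivity and existence of the pressure\<close>

locale bernoulli_potential = finite_alphabet S for S :: "'s set" +
  fixes f :: "(nat \<Rightarrow> 's) \<Rightarrow> real"
  assumes bounded_variation: "bounded_variation S f"
begin

text \<open>The index is shifted: \<open>osc n\<close> controls sequences agreeing on coordinates 0
  to \<open>n\<close>, thus on \<open>n + 1\<close> of them. The terms of a finite series in
  \<open>ennreal\<close> are finite, so \<open>enn2real\<close> loses nothing.\<close>

definition osc :: "nat \<Rightarrow> real" where
  "osc n = enn2real (Defs.var S (Suc n) f)"

lemma var_finite: "Defs.var S (Suc n) f < \<top>"
  using bounded_variation ennreal_suminf_lessD[of "\<lambda>n. Defs.var S (Suc n) f" \<top> n]
  by (simp add: bounded_variation_def)

lemma ennreal_osc: "ennreal (osc n) = Defs.var S (Suc n) f"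
  unfolding osc_def using var_finite by (rule ennreal_enn2real)

lemma osc_nonneg: "0 \<le> osc n"
  by (simp add: osc_def)

lemma summable_osc: "summable osc"
proof (rule summable_suminf_not_top)
  show "(\<Sum>i. ennreal (osc i)) \<noteq> \<top>"
    using bounded_variation by (simp add: ennreal_osc bounded_variation_def less_top)
qed (rule osc_nonneg)

lemma abs_diff_le_osc:
  assumes "x \<in> seqs S" "y \<in> seqs S" "\<And>k. k \<le> n \<Longrightarrow> x k = y k"
  shows "\<bar>f x - f y\<bar> \<le> osc n"
proof -
  have "(x, y) \<in> agreeing S (Suc n)" using assms by (simp add: agreeing_def less_Suc_eq_le)
  then have "ennreal \<bar>f x - f y\<bar> \<le> Defs.var S (Suc n) f"
    unfolding Defs.var_def by (rule SUP_upper2) simp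
  then show ?thesis using osc_nonneg by (simp add: ennreal_osc[symmetric])
qed

text \<open>Variation controls \<open>f\<close> only within cylinders of length 1; the finitely many
  values at one-letter words anchor it.\<close>

definition f_bound :: real where
  "f_bound = osc 0 + (\<Sum>c\<in>words 1. \<bar>f c\<bar>)"

lemma f_bound_nonneg: "0 \<le> f_bound"
  using osc_nonneg[of 0] by (simp add: f_bound_def add_nonneg_nonneg sum_nonneg)

lemma abs_f_le: "x \<in> seqs S \<Longrightarrow> \<bar>f x\<bar> \<le> f_bound"
proof -
  assume x: "x \<in> seqs S"
  have "\<bar>f x - f (pad 1 x)\<bar> \<le> osc 0"
    using x by (intro abs_diff_le_osc pad_in_seqs) (auto simp: pad_less)
  moreover have "\<bar>f (pad 1 x)\<bar> \<le> (\<Sum>c\<in>words 1. \<bar>f c\<bar>)"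
    using x finite_words by (intro member_le_sum) (auto simp: words_def)
  ultimately show ?thesis by (simp add: f_bound_def)
qed

text \<open>Bounded variation makes \<open>f\<close> the pointwise limit of functions of finitely
  many coordinates, which are measurable.\<close>

lemma f_measurable [measurable]: "f \<in> borel_measurable (bernoulli S)"
proof (rule borel_measurable_LIMSEQ_real)
  show "(\<lambda>x. f (pad n x)) \<in> borel_measurable (bernoulli S)" for n
    using integrable_cylinder_function[of f n] by (rule borel_measurable_integrable)
  fix x assume "x \<in> space (bernoulli S)"
  then have x: "x \<in> seqs S" by (simp add: space_bernoulli)
  show "(\<lambda>n. f (pad n x)) \<longlonglongrightarrow> f x"
  proof (rule LIMSEQ_imp_Suc, rule metric_tendsto_imp_tendsto[OF summable_LIMSEQ_zero[OF summable_osc]])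
    have "dist (f (pad (Suc n) x)) (f x) \<le> dist (osc n) 0" for n
      using abs_diff_le_osc[OF pad_in_seqs[OF x] x, of n "Suc n"] osc_nonneg[of n]
      by (simp add: dist_real_def pad_less)
    then show "\<forall>\<^sub>F n in sequentially. dist (f (pad (Suc n) x)) (f x) \<le> dist (osc n) 0"
      by simp
  qed
qed

text \<open>After \<open>k\<close> shifts the two sequences still agree on \<open>n - k\<close>
  coordinates, so the \<open>k\<close>-th term is at most \<open>B * osc (n - Suc k)\<close>. Read
  backwards, these bounds form a partial sum of a convergent series.\<close>

lemma distortion_bound:
  assumes w: "\<And>k. \<bar>w k\<bar> \<le> B"
    and xy: "x \<in> seqs S" "y \<in> seqs S" "\<And>k. k < n \<Longrightarrow> x k = y k"
  shows "(\<Sum>k<n. \<bar>w k * f ((left_shift ^^ k) x) - w k * f ((left_shift ^^ k) y)\<bar>) \<le> B * suminf osc"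
proof -
  have B: "0 \<le> B" using w[of 0] by simp
  have "(\<Sum>k<n. \<bar>w k * f ((left_shift ^^ k) x) - w k * f ((left_shift ^^ k) y)\<bar>)
      \<le> (\<Sum>k<n. B * osc (n - Suc k))"
  proof (rule sum_mono)
    fix k assume k: "k \<in> {..<n}"
    have "\<bar>f ((left_shift ^^ k) x) - f ((left_shift ^^ k) y)\<bar> \<le> osc (n - Suc k)"
      using xy k by (intro abs_diff_le_osc seqs_funpow_left_shift) (auto simp: funpow_left_shift)
    then have "\<bar>w k\<bar> * \<bar>f ((left_shift ^^ k) x) - f ((left_shift ^^ k) y)\<bar> \<le> B * osc (n - Suc k)"
      using w[of k] B by (intro mult_mono) auto
    then show "\<bar>w k * f ((left_shift ^^ k) x) - w k * f ((left_shift ^^ k) y)\<bar> \<le> B * osc (n - Suc k)"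
      by (simp add: abs_mult right_diff_distrib[symmetric])
  qed
  also have "\<dots> = B * (\<Sum>k<n. osc k)"
    using sum.nat_diff_reindex[of osc n] by (simp add: sum_distrib_left[symmetric])
  also have "\<dots> \<le> B * suminf osc"
    using B osc_nonneg summable_osc by (intro mult_left_mono sum_le_suminf) auto
  finally show ?thesis .
qed

lemma H2_if_bounded:
  assumes w: "\<And>k. \<bar>w k\<bar> \<le> B"
  shows "H2 S f w"
proof -
  have "(SUP N\<in>{1..}. SUP (x, y)\<in>agreeing S N.
      ennreal (\<Sum>k<N. \<bar>w k * f ((left_shift ^^ k) x) - w k * f ((left_shift ^^ k) y)\<bar>))
    \<le> ennreal (B * suminf osc)"
  proof (intro SUP_least, clarify)
    fix N x y assume "(x, y) \<in> agreeing S N"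
    then show "ennreal (\<Sum>k<N. \<bar>w k * f ((left_shift ^^ k) x) - w k * f ((left_shift ^^ k) y)\<bar>)
        \<le> ennreal (B * suminf osc)"
      by (intro ennreal_leI distortion_bound[OF w]) (auto simp: agreeing_def)
  qed
  then show ?thesis unfolding H2_def by (rule le_less_trans) simp
qed

lemma energy_distortion:
  assumes w: "\<And>k. \<bar>w k\<bar> \<le> B"
    and xy: "x \<in> seqs S" "y \<in> seqs S" "\<And>k. k < n \<Longrightarrow> x k = y k"
  shows "\<bar>energy f w n x - energy f w n y\<bar> \<le> B * suminf osc"
proof -
  have "(\<Sum>k<n. \<bar>w k * f ((left_shift ^^ k) x) - w k * f ((left_shift ^^ k) y)\<bar>) \<le> B * suminf osc"
    by (rule distortion_bound) (use assms in auto)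
  then show ?thesis
    unfolding energy_def sum_subtractf[symmetric] by (rule order_trans[OF sum_abs])
qed

lemma abs_energy_le:
  assumes w: "\<And>k. \<bar>w k\<bar> \<le> B" and x: "x \<in> seqs S"
  shows "\<bar>energy f w n x\<bar> \<le> real n * (B * f_bound)"
proof -
  have B: "0 \<le> B" using w[of 0] by simp
  have "\<bar>w k * f ((left_shift ^^ k) x)\<bar> \<le> B * f_bound" for k
    unfolding abs_mult using w[of k] B abs_f_le[OF seqs_funpow_left_shift[OF x]] by (intro mult_mono) auto
  then have "(\<Sum>k<n. \<bar>w k * f ((left_shift ^^ k) x)\<bar>) \<le> (\<Sum>k<n. B * f_bound)"
    by (intro sum_mono)
  then show ?thesis
    unfolding energy_def by (intro order_trans[OF sum_abs]) simp
qed

lemma energy_measurable [measurable]: "energy f w n \<in> borel_measurable (bernoulli S)"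
  unfolding energy_def[abs_def] by measurable

lemma partition_fn_measurable [measurable]:
  "partition_fn S f n lam \<in> borel_measurable (\<Pi>\<^sub>M n\<in>UNIV. borel)"
proof -
  have "(\<lambda>(w, x). exp (lam * (\<Sum>k<n. w k * f ((left_shift ^^ k) x))))
      \<in> borel_measurable ((\<Pi>\<^sub>M n\<in>(UNIV::nat set). borel) \<Otimes>\<^sub>M bernoulli S)"
    by measurable
  from B.borel_measurable_lebesgue_integral[OF this] show ?thesis
    by (simp add: partition_fn_def[abs_def])
qed

section \<open>Log partition functions along bounded weights\<close>

context
  fixes B :: real
begin

definition bounded_weights :: "(nat \<Rightarrow> real) set" where
  "bounded_weights = {w. \<forall>k. \<bar>w k\<bar> \<le> B}"

lemma bounded_weightsD: "w \<in> bounded_weights \<Longrightarrow> \<bar>w k\<bar> \<le> B"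
  by (simp add: bounded_weights_def)

lemma bounded_weights_nonneg: "w \<in> bounded_weights \<Longrightarrow> 0 \<le> B"
  using bounded_weightsD[of w 0] by simp

lemma bounded_weights_shift: "w \<in> bounded_weights \<Longrightarrow> (left_shift ^^ n) w \<in> bounded_weights"
  by (simp add: bounded_weights_def funpow_left_shift)

text \<open>The map \<open>T\<close> is the identity in the estimates below and the insertion of a
  fixed word in the later block recursion.\<close>

lemma exp_energy_comp_integrable:
  assumes w: "w \<in> bounded_weights" and T: "T \<in> measurable (bernoulli S) (bernoulli S)"
  shows "integrable (bernoulli S) (\<lambda>x. exp (lam * energy f w n (T x)))"
proof (rule B.integrable_const_bound[where B = "exp (\<bar>lam\<bar> * (real n * (B * f_bound)))"])
  show "AE x in bernoulli S. norm (exp (lam * energy f w n (T x))) \<le> exp (\<bar>lam\<bar> * (real n * (B * f_bound)))"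
  proof (rule AE_I2)
    fix x assume "x \<in> space (bernoulli S)"
    then have "T x \<in> seqs S" using measurable_space[OF T] by (simp add: space_bernoulli)
    then have "\<bar>energy f w n (T x)\<bar> \<le> real n * (B * f_bound)"
      using w by (intro abs_energy_le bounded_weightsD)
    then have "\<bar>lam\<bar> * \<bar>energy f w n (T x)\<bar> \<le> \<bar>lam\<bar> * (real n * (B * f_bound))"
      by (rule mult_left_mono) simp
    then show "norm (exp (lam * energy f w n (T x))) \<le> exp (\<bar>lam\<bar> * (real n * (B * f_bound)))"
      using abs_ge_self[of "lam * energy f w n (T x)"] by (simp add: abs_mult)
  qed
  note [measurable] = T
  show "(\<lambda>x. exp (lam * energy f w n (T x))) \<in> borel_measurable (bernoulli S)"
    by measurable
qed

lemmas exp_energy_integrable = exp_energy_comp_integrable[OF _ measurable_ident_sets[OF refl]]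

text \<open>Pointwise, the exponents at \<open>lam\<close> and \<open>mu\<close> differ by at most
  \<open>\<bar>lam - mu\<bar>\<close> times the bound on the energy. Comparison with parameter 0,
  where the partition function is 1, later gives positivity.\<close>

lemma partition_fn_le:
  assumes w: "w \<in> bounded_weights"
  shows "partition_fn S f n lam w \<le> exp (\<bar>lam - mu\<bar> * (real n * (B * f_bound))) * partition_fn S f n mu w"
proof -
  have "partition_fn S f n lam w \<le>
      (\<integral>x. exp (\<bar>lam - mu\<bar> * (real n * (B * f_bound))) * exp (mu * energy f w n x) \<partial>bernoulli S)"
    unfolding partition_fn_energy
  proof (rule integral_mono)
    fix x assume "x \<in> space (bernoulli S)"
    then have "\<bar>energy f w n x\<bar> \<le> real n * (B * f_bound)"
      using w by (intro abs_energy_le bounded_weightsD) (auto simp: space_bernoulli)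
    then have "\<bar>lam - mu\<bar> * \<bar>energy f w n x\<bar> \<le> \<bar>lam - mu\<bar> * (real n * (B * f_bound))"
      by (rule mult_left_mono) simp
    then have "(lam - mu) * energy f w n x \<le> \<bar>lam - mu\<bar> * (real n * (B * f_bound))"
      using abs_ge_self[of "(lam - mu) * energy f w n x"] by (simp add: abs_mult)
    then show "exp (lam * energy f w n x) \<le>
        exp (\<bar>lam - mu\<bar> * (real n * (B * f_bound))) * exp (mu * energy f w n x)"
      by (simp add: exp_add[symmetric] algebra_simps)
  qed (use exp_energy_integrable[OF w] in auto)
  then show ?thesis by (simp add: partition_fn_energy)
qed

lemma partition_fn_0: "partition_fn S f n 0 w = 1"
  by (simp add: partition_fn_def B.prob_space)

lemma partition_fn_pos:
  assumes w: "w \<in> bounded_weights"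
  shows "0 < partition_fn S f n lam w"
proof -
  have "0 < exp (\<bar>0 - lam\<bar> * (real n * (B * f_bound))) * partition_fn S f n lam w"
    using partition_fn_le[OF w, of n 0 lam] unfolding partition_fn_0 by linarith
  then show ?thesis by (simp add: zero_less_mult_iff)
qed

definition log_partition :: "nat \<Rightarrow> real \<Rightarrow> (nat \<Rightarrow> real) \<Rightarrow> real" where
  "log_partition n lam w = ln (partition_fn S f n lam w)"

text \<open>The Lipschitz constant is linear in \<open>n\<close>, hence uniform after division by
  \<open>n\<close>; this carries estimates from rational to real parameters.\<close>

lemma log_partition_lipschitz:
  assumes w: "w \<in> bounded_weights"
  shows "\<bar>log_partition n lam w - log_partition n mu w\<bar> \<le> \<bar>lam - mu\<bar> * (real n * (B * f_bound))"
proof -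
  have *: "log_partition n a w \<le> \<bar>a - b\<bar> * (real n * (B * f_bound)) + log_partition n b w" for a b
  proof -
    have "log_partition n a w \<le> ln (exp (\<bar>a - b\<bar> * (real n * (B * f_bound))) * partition_fn S f n b w)"
      unfolding log_partition_def using partition_fn_pos[OF w] partition_fn_le[OF w, of n a b]
      by (intro ln_mono) auto
    also have "\<dots> = \<bar>a - b\<bar> * (real n * (B * f_bound)) + log_partition n b w"
      using partition_fn_pos[OF w, of n b] by (simp add: ln_mult log_partition_def)
    finally show ?thesis .
  qed
  show ?thesis using *[of lam mu] *[of mu lam] by (simp add: abs_minus_commute)
qed

lemma abs_log_partition_le:
  assumes w: "w \<in> bounded_weights"
  shows "\<bar>log_partition n lam w\<bar> \<le> \<bar>lam\<bar> * (real n * (B * f_bound))"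
  using log_partition_lipschitz[OF w, of n lam 0] by (simp add: log_partition_def partition_fn_0)

text \<open>The energy of the first \<open>n\<close> terms depends on the coordinates from \<open>n\<close> on only up to a bounded
  error, and the remaining ones are independent of the first \<open>n\<close>.\<close>

lemma log_partition_almost_additive:
  assumes w: "w \<in> bounded_weights"
  shows "\<bar>log_partition (n + m) lam w - log_partition n lam w - log_partition m lam ((left_shift ^^ n) w)\<bar>
    \<le> \<bar>lam\<bar> * (B * suminf osc)"
proof -
  let ?w = "(left_shift ^^ n) w"
  let ?C = "\<bar>lam\<bar> * (B * suminf osc)"
  let ?e = "\<lambda>x. exp (lam * energy f w n x)" and ?e' = "\<lambda>y. exp (lam * energy f ?w m y)"
  let ?E = "\<lambda>x. exp (lam * energy f w (n + m) x)"
  have w': "?w \<in> bounded_weights" using w by (rule bounded_weights_shift)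
  have bnd: "?E (comb_seq n x y) \<le> exp ?C * (?e x * ?e' y)"
      "exp (- ?C) * (?e x * ?e' y) \<le> ?E (comb_seq n x y)"
    if xy: "x \<in> seqs S" "y \<in> seqs S" for x y
  proof -
    have "\<bar>energy f w n (comb_seq n x y) - energy f w n x\<bar> \<le> B * suminf osc"
      using w xy by (intro energy_distortion bounded_weightsD seqs_comb_seq) (auto simp: comb_seq_less)
    then have "\<bar>lam\<bar> * \<bar>energy f w n (comb_seq n x y) - energy f w n x\<bar> \<le> ?C"
      by (rule mult_left_mono) simp
    then have "\<bar>lam * energy f w n (comb_seq n x y) - lam * energy f w n x\<bar> \<le> ?C"
      by (simp add: abs_mult[symmetric] algebra_simps)
    moreover have "energy f w (n + m) (comb_seq n x y) = energy f w n (comb_seq n x y) + energy f ?w m y"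
      by (simp add: energy_add left_shift_comb_seq)
    ultimately show "?E (comb_seq n x y) \<le> exp ?C * (?e x * ?e' y)"
      "exp (- ?C) * (?e x * ?e' y) \<le> ?E (comb_seq n x y)"
      by (simp_all add: exp_add[symmetric] distrib_left abs_le_iff)
  qed
  note iE = integral_comb_seq[OF exp_energy_integrable[OF w, of lam "n + m"], of n]
  have iP: "integrable (bernoulli S \<Otimes>\<^sub>M bernoulli S) (\<lambda>(x, y). ?e x * ?e' y)"
  proof (rule BB.Fubini_integrable)
    show "(\<lambda>(x, y). ?e x * ?e' y) \<in> borel_measurable (bernoulli S \<Otimes>\<^sub>M bernoulli S)"
      by measurable
    show "integrable (bernoulli S) (\<lambda>x. \<integral>y. norm (case (x, y) of (x, y) \<Rightarrow> ?e x * ?e' y) \<partial>bernoulli S)"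
      using exp_energy_integrable[OF w] by (simp add: abs_mult)
    show "AE x in bernoulli S. integrable (bernoulli S) (\<lambda>y. case (x, y) of (x, y) \<Rightarrow> ?e x * ?e' y)"
      using exp_energy_integrable[OF w'] by simp
  qed
  \<comment> \<open>Under the product measure the two factors separate; \<open>bnd\<close> then
    compares their product with the partition function of length \<open>n + m\<close>.\<close>
  have P: "(\<integral>(x, y). ?e x * ?e' y \<partial>(bernoulli S \<Otimes>\<^sub>M bernoulli S))
      = partition_fn S f n lam w * partition_fn S f m lam ?w"
    using BB.integral_fst'[OF iP] by (simp add: partition_fn_energy)
  have E: "(\<integral>(x, y). ?E (comb_seq n x y) \<partial>(bernoulli S \<Otimes>\<^sub>M bernoulli S)) = partition_fn S f (n + m) lam w"
    using BB.integral_fst'[OF iE(1)] iE(2) by (simp add: partition_fn_energy)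
  have up: "partition_fn S f (n + m) lam w \<le> exp ?C * (partition_fn S f n lam w * partition_fn S f m lam ?w)"
    unfolding P[symmetric] E[symmetric] integral_mult_right_zero[symmetric]
    by (rule integral_mono) (use iE iP bnd in \<open>auto simp: space_pair_measure space_bernoulli case_prod_unfold\<close>)
  have lo: "exp (- ?C) * (partition_fn S f n lam w * partition_fn S f m lam ?w) \<le> partition_fn S f (n + m) lam w"
    unfolding P[symmetric] E[symmetric] integral_mult_right_zero[symmetric]
    by (rule integral_mono) (use iE iP bnd in \<open>auto simp: space_pair_measure space_bernoulli case_prod_unfold\<close>)
  note pos = partition_fn_pos[OF w, of n lam] partition_fn_pos[OF w', of m lam] partition_fn_pos[OF w, of "n + m" lam]
  have "log_partition (n + m) lam w \<le> ?C + (log_partition n lam w + log_partition m lam ?w)"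
    using ln_mono[OF up pos(3)] pos by (simp add: log_partition_def ln_mult)
  moreover have "- ?C + (log_partition n lam w + log_partition m lam ?w) \<le> log_partition (n + m) lam w"
    using ln_mono[OF lo] pos by (simp add: log_partition_def ln_mult)
  ultimately show ?thesis by linarith
qed

text \<open>Summing the almost additive relation \<open>a (j + m) - a j \<approx> a m (\<theta>^j w)\<close> over \<open>j < n\<close> telescopes
  on the left to a quantity close to \<open>m * a n\<close>.\<close>

lemma log_partition_birkhoff:
  assumes w: "w \<in> bounded_weights"
  shows "\<bar>real m * log_partition n lam w - birkhoff_sum left_shift (log_partition m lam) n w\<bar>
    \<le> real n * (\<bar>lam\<bar> * (B * suminf osc))
      + real m * (\<bar>lam\<bar> * (B * suminf osc) + 2 * (\<bar>lam\<bar> * (real m * (B * f_bound))))"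
proof -
  let ?a = "\<lambda>n. log_partition n lam w" and ?C = "\<bar>lam\<bar> * (B * suminf osc)"
  let ?D = "\<bar>lam\<bar> * (real m * (B * f_bound))"
  have "(\<Sum>j<n. ?a (j + m) - ?a j) = (\<Sum>i<m. ?a (n + i) - ?a i)"
  proof (induction n)
    case (Suc n)
    have "(\<Sum>i<m. ?a (Suc n + i) - ?a i) - (\<Sum>i<m. ?a (n + i) - ?a i) = (\<Sum>i<m. ?a (n + Suc i) - ?a (n + i))"
      by (simp add: sum_subtractf)
    also have "\<dots> = ?a (n + m) - ?a n"
      using sum_lessThan_telescope[of "\<lambda>i. ?a (n + i)" m] by simp
    finally show ?case using Suc by simp
  qed simp
  then have "real m * ?a n - birkhoff_sum left_shift (log_partition m lam) n w
      = (\<Sum>j<n. ?a (j + m) - ?a j - log_partition m lam ((left_shift ^^ j) w))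
        - (\<Sum>i<m. (?a (n + i) - ?a n - ?a i))"
    by (simp add: birkhoff_sum_def sum_subtractf)
  moreover have "\<bar>\<Sum>j<n. ?a (j + m) - ?a j - log_partition m lam ((left_shift ^^ j) w)\<bar> \<le> (\<Sum>j<n. ?C)"
    using log_partition_almost_additive[OF w, of _ m lam]
    by (intro order_trans[OF sum_abs] sum_mono)
  \<comment> \<open>By almost additivity each term is within \<open>?C\<close> of the difference of
    \<open>log_partition i lam\<close> at the shifted weights and at \<open>w\<close>. Both values
    are at most \<open>?D\<close> in modulus because \<open>i < m\<close>.\<close>
  moreover have "\<bar>\<Sum>i<m. (?a (n + i) - ?a n - ?a i)\<bar> \<le> (\<Sum>i<m. ?C + 2 * ?D)"
  proof (intro order_trans[OF sum_abs] sum_mono)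
    fix i assume "i \<in> {..<m}"
    then have le: "\<bar>lam\<bar> * (real i * (B * f_bound)) \<le> ?D"
      using bounded_weights_nonneg[OF w] f_bound_nonneg by (intro mult_left_mono mult_right_mono) auto
    have "\<bar>log_partition i lam v\<bar> \<le> ?D" if "v \<in> bounded_weights" for v
      using abs_log_partition_le[OF that, of i lam] le by linarith
    from this[OF w] this[OF bounded_weights_shift[OF w, of n]] log_partition_almost_additive[OF w, of n i lam]
    show "\<bar>?a (n + i) - ?a n - ?a i\<bar> \<le> ?C + 2 * ?D" by linarith
  qed
  ultimately show ?thesis by simp
qed

text \<open>Restricting to countably many parameters and lengths keeps the exceptional set null. The
  averages \<open>\<beta>\<close> do not depend on \<open>w\<close>, and membership yields both
  convergence and the value of the pressure.\<close>

definition typical_weights :: "(rat \<Rightarrow> nat \<Rightarrow> real) \<Rightarrow> (nat \<Rightarrow> real) set" where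
  "typical_weights \<beta> = {w \<in> bounded_weights. \<forall>q m.
     (\<lambda>n. birkhoff_sum left_shift (log_partition m (of_rat q)) n w / real n) \<longlonglongrightarrow> \<beta> q m}"

lemma typical_weightsD:
  assumes "w \<in> typical_weights \<beta>"
  shows "w \<in> bounded_weights"
    and "(\<lambda>n. birkhoff_sum left_shift (log_partition m (of_rat q)) n w / real n) \<longlonglongrightarrow> \<beta> q m"
  using assms by (auto simp: typical_weights_def)

text \<open>The number \<open>r\<close> is chosen before \<open>w\<close>, so closeness gives both
  the Cauchy property for one \<open>w\<close> and equal limits for different ones. The candidate is
  \<open>\<beta> q m / real m\<close>, with \<open>q\<close> a rational near \<open>lam\<close> and
  \<open>m\<close> large.\<close>

lemma log_partition_eventually_close:
  assumes e: "0 < e"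
  shows "\<exists>r. \<forall>w\<in>typical_weights \<beta>. \<forall>\<^sub>F n in sequentially. \<bar>log_partition n lam w / real n - r\<bar> \<le> e"
proof (cases "0 \<le> B")
  case False
  then have "typical_weights \<beta> = {}" using bounded_weights_nonneg typical_weightsD(1) by blast
  then show ?thesis by simp
next
  case B: True
  define K where "K = B * f_bound"
  have K: "0 \<le> K" unfolding K_def using B f_bound_nonneg by simp
  \<comment> \<open>Replacing \<open>lam\<close> by \<open>q\<close> costs at most
    \<open>e / 4\<close> after division by \<open>n\<close>; \<open>K + 1\<close> avoids a zero
    denominator.\<close>
  obtain q :: rat where q: "lam < of_rat q" "of_rat q < lam + e / (4 * (K + 1))"
    using of_rat_dense[of lam "lam + e / (4 * (K + 1))"] e K by auto
  have qK: "\<bar>lam - of_rat q\<bar> * K \<le> e / 4"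
  proof -
    have "\<bar>lam - of_rat q\<bar> * K \<le> e / (4 * (K + 1)) * (K + 1)"
      using q K by (intro mult_mono) auto
    also have "\<dots> = e / 4" using K by (simp add: field_simps)
    finally show ?thesis .
  qed
  define C where "C = \<bar>of_rat q\<bar> * (B * suminf osc)"
  \<comment> \<open>The length \<open>m\<close> absorbs the almost-additivity error
    \<open>C\<close>, while the boundary error \<open>D\<close> defined next is absorbed by large
    \<open>n\<close>.\<close>
  obtain m :: nat where m: "C / (e / 4) < real m" "1 \<le> m"
    using reals_Archimedean2[of "max 1 (C / (e / 4))"] by (auto simp: max_def split: if_splits)
  then have Cm: "C \<le> real m * (e / 4)" using e by (simp add: field_simps)
  define D where "D = C + 2 * (\<bar>of_rat q\<bar> * (real m * (B * f_bound)))"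
  show ?thesis
  proof (intro exI ballI)
    fix w assume w: "w \<in> typical_weights \<beta>"
    note wb = typical_weightsD(1)[OF w]
    let ?bs = "\<lambda>n. birkhoff_sum left_shift (log_partition m (of_rat q)) n w"
    have "\<forall>\<^sub>F n in sequentially. dist (?bs n / real n) (\<beta> q m) < e / 4"
      by (rule tendstoD[OF typical_weightsD(2)[OF w]]) (use e in simp)
    moreover have "\<forall>\<^sub>F n in sequentially. 1 \<le> n \<and> D \<le> real n * (e / 4)"
    proof -
      obtain N :: nat where "D / (e / 4) < real N" using reals_Archimedean2 by blast
      then have "1 \<le> n \<and> D \<le> real n * (e / 4)" if "n \<ge> max 1 N" for n
      proof -
        have "D / (e / 4) \<le> real n" using that \<open>D / (e / 4) < real N\<close> by simp
        then show ?thesis using that e by (simp add: field_simps)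
      qed
      then show ?thesis by (rule eventually_sequentiallyI)
    qed
    ultimately show "\<forall>\<^sub>F n in sequentially. \<bar>log_partition n lam w / real n - \<beta> q m / real m\<bar> \<le> e"
    proof eventually_elim
      case (elim n)
      let ?a = "log_partition n lam w" and ?aq = "log_partition n (of_rat q) w"
      have n: "0 < real n" using elim by simp
      have 1: "\<bar>?bs n - real n * \<beta> q m\<bar> \<le> real n * (e / 4)"
      proof -
        have "?bs n - real n * \<beta> q m = real n * (?bs n / real n - \<beta> q m)"
          using n by (simp add: field_simps)
        then have "\<bar>?bs n - real n * \<beta> q m\<bar> = real n * \<bar>?bs n / real n - \<beta> q m\<bar>"
          by (simp add: abs_mult)
        also have "\<dots> \<le> real n * (e / 4)"
          using elim(1) n by (intro mult_left_mono) (auto simp: dist_real_def)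
        finally show ?thesis .
      qed
      have 2: "\<bar>real m * ?aq - ?bs n\<bar> \<le> real n * C + real m * D"
        using log_partition_birkhoff[OF wb, of m n "of_rat q"] by (simp add: C_def D_def)
      have 3: "real m * \<bar>?a - ?aq\<bar> \<le> real m * (real n * (e / 4))"
      proof (rule mult_left_mono)
        have "\<bar>?a - ?aq\<bar> \<le> real n * (\<bar>lam - of_rat q\<bar> * K)"
          using log_partition_lipschitz[OF wb, of n lam "of_rat q"] by (simp add: K_def ac_simps)
        also have "\<dots> \<le> real n * (e / 4)" using qK by (intro mult_left_mono) auto
        finally show "\<bar>?a - ?aq\<bar> \<le> real n * (e / 4)" .
      qed simp
      have 4: "real n * C \<le> real m * (real n * (e / 4))"
        using mult_left_mono[OF Cm, of "real n"] by (simp add: ac_simps)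
      have 5: "real m * D \<le> real m * (real n * (e / 4))" using elim by (intro mult_left_mono) auto
      have 6: "real n * (e / 4) \<le> real m * (real n * (e / 4))"
        using m(2) e mult_right_mono[of 1 "real m" "real n * (e / 4)"] by simp
      have "real m * ?a - real m * ?aq = real m * (?a - ?aq)" by (simp add: right_diff_distrib)
      then have "\<bar>real m * ?a - real m * ?aq\<bar> = real m * \<bar>?a - ?aq\<bar>" by (simp add: abs_mult)
      \<comment> \<open>The four quarters are the change of parameter, the \<open>n\<close>
        almost-additivity errors, the boundary terms, and the deviation of the Birkhoff
        average.\<close>
      with 1 2 3 4 5 6 have "\<bar>real m * ?a - real n * \<beta> q m\<bar> \<le> 4 * (real m * (real n * (e / 4)))"
        by linarith
      moreover have "?a / real n - \<beta> q m / real m = (real m * ?a - real n * \<beta> q m) / (real m * real n)"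
        using n m(2) by (simp add: field_simps)
      ultimately show ?case using n m(2) by (simp add: abs_divide divide_le_eq ac_simps)
    qed
  qed
qed

lemma log_partition_convergent:
  assumes w: "w \<in> typical_weights \<beta>"
  shows "convergent (\<lambda>n. log_partition n lam w / real n)"
proof (rule Cauchy_convergent, rule CauchyI)
  fix e :: real assume e: "0 < e"
  obtain r where "\<forall>\<^sub>F n in sequentially. \<bar>log_partition n lam w / real n - r\<bar> \<le> e / 3"
    using log_partition_eventually_close[of "e / 3" \<beta> lam] e w by auto
  then obtain N where N: "\<And>n. n \<ge> N \<Longrightarrow> \<bar>log_partition n lam w / real n - r\<bar> \<le> e / 3"
    by (auto simp: eventually_sequentially)
  have "norm (log_partition m lam w / real m - log_partition n lam w / real n) < e"
    if "m \<ge> N" "n \<ge> N" for m n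
    using N[OF that(1)] N[OF that(2)] e unfolding real_norm_def by linarith
  then show "\<exists>M. \<forall>m\<ge>M. \<forall>n\<ge>M. norm (log_partition m lam w / real m - log_partition n lam w / real n) < e"
    by blast
qed

lemma H1_typical:
  assumes "w \<in> typical_weights \<beta>"
  shows "H1 S f w"
  using log_partition_convergent[OF assms] by (simp add: H1_def log_partition_def)

lemma log_partition_tendsto_pressure:
  assumes "w \<in> typical_weights \<beta>"
  shows "(\<lambda>n. log_partition n lam w / real n) \<longlonglongrightarrow> pressure S f w lam"
  using log_partition_convergent[OF assms, of lam]
  by (simp add: convergent_LIMSEQ_iff pressure_def log_partition_def)

text \<open>Both limits lie within \<open>e / 2\<close> of the same \<open>r\<close>, which does not
  depend on the weights.\<close>

lemma pressure_typical_unique: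
  assumes v: "v \<in> typical_weights \<beta>" and w: "w \<in> typical_weights \<beta>"
  shows "pressure S f v = pressure S f w"
proof
  fix lam
  have "\<bar>pressure S f v lam - pressure S f w lam\<bar> \<le> e" if e: "0 < e" for e
  proof -
    obtain r where r: "\<And>u. u \<in> typical_weights \<beta> \<Longrightarrow>
        \<forall>\<^sub>F n in sequentially. \<bar>log_partition n lam u / real n - r\<bar> \<le> e / 2"
      using log_partition_eventually_close[of "e / 2" \<beta> lam] e by auto
    have "\<bar>pressure S f u lam - r\<bar> \<le> e / 2" if u: "u \<in> typical_weights \<beta>" for u
      by (rule tendsto_upperbound[OF tendsto_rabs[OF tendsto_diff[OF log_partition_tendsto_pressure[OF u] tendsto_const]] r[OF u]])
        simp
    from this[OF v] this[OF w] show ?thesis by linarith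
  qed
  then have "\<bar>pressure S f v lam - pressure S f w lam\<bar> \<le> 0" by (rule field_le_epsilon[where y = 0, simplified])
  then show "pressure S f v lam = pressure S f w lam" by simp
qed

text \<open>Birkhoff's theorem is applied on the space of weight sequences, with the shift as
  transformation and \<open>log_partition m (of_rat q)\<close> as observable; countably many null
  sets are discarded.\<close>

lemma AE_typical_weights:
  assumes P: "prob_space P" and sets: "sets P = sets (\<Pi>\<^sub>M n\<in>UNIV. borel)"
    and pres: "distr P P left_shift = P"
    and erg: "\<And>A. A \<in> sets P \<Longrightarrow> left_shift -` A = A \<Longrightarrow> measure P A = 0 \<or> measure P A = 1"
    and bnd: "AE w in P. w \<in> bounded_weights"
  shows "AE w in P. w \<in> typical_weights (\<lambda>q m. \<integral>w. log_partition m (of_rat q) w \<partial>P)"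
proof -
  interpret P: prob_space P by (rule P)
  have space: "space P = UNIV" using sets_eq_imp_space_eq[OF sets] by (simp add: space_PiM)
  have T: "left_shift \<in> measurable P P"
    using left_shift_measurable measurable_cong_sets[OF sets sets] by blast
  have int: "integrable P (log_partition m lam)" for m lam
  proof (rule P.integrable_const_bound)
    show "AE w in P. norm (log_partition m lam w) \<le> \<bar>lam\<bar> * (real m * (B * f_bound))"
      using bnd by eventually_elim (simp add: abs_log_partition_le)
    have "log_partition m lam \<in> borel_measurable (\<Pi>\<^sub>M n\<in>UNIV. borel)"
      unfolding log_partition_def[abs_def] by measurable
    then show "log_partition m lam \<in> borel_measurable P"
      using measurable_cong_sets[OF sets refl] by blast
  qed
  have "AE w in P. \<forall>q m. (\<lambda>n. birkhoff_sum left_shift (log_partition m (of_rat q)) n w / real n)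
      \<longlonglongrightarrow> (\<integral>w. log_partition m (of_rat q) w \<partial>P)"
    unfolding AE_all_countable
    by (intro allI birkhoff_ergodic[OF P T pres int]) (auto simp: space erg)
  with bnd show ?thesis by eventually_elim (simp add: typical_weights_def)
qed

end

end

section \<open>Products of positive matrices\<close>

lemma fps_expansion_Re:
  fixes g :: "complex \<Rightarrow> complex"
  assumes "g has_fps_expansion A"
  shows "(\<lambda>h::real. Re (g (of_real h))) has_fps_expansion Abs_fps (\<lambda>n. Re (fps_nth A n))"
proof -
  let ?R = "Abs_fps (\<lambda>n. Re (fps_nth A n))"
  have pos: "0 < fps_conv_radius A" and ev: "\<forall>\<^sub>F z in nhds 0. eval_fps A z = g z"
    using assms by (auto simp: has_fps_expansion_def)
  have sums: "(\<lambda>n. fps_nth ?R n * h ^ n) sums Re (eval_fps A (of_real h))"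
    if "ereal (norm h) < fps_conv_radius A" for h :: real
  proof -
    have "(\<lambda>n. fps_nth A n * of_real h ^ n) sums eval_fps A (of_real h)"
      using that by (intro sums_eval_fps) simp
    then have "(\<lambda>n. Re (fps_nth A n * of_real h ^ n)) sums Re (eval_fps A (of_real h))"
      by (rule sums_Re)
    then show ?thesis by (simp flip: of_real_power)
  qed
  \<comment> \<open>Convergence of the series of real parts at every positive radius below the old
    one bounds the new radius from below.\<close>
  have rad: "fps_conv_radius A \<le> fps_conv_radius ?R"
    unfolding fps_conv_radius_def
  proof (rule conv_radius_geI_ex')
    fix r :: real assume r: "0 < r" "ereal r < conv_radius (fps_nth A)"
    then show "summable (\<lambda>n. fps_nth ?R n * of_real r ^ n)"
      using sums_summable[OF sums[of r]] by (simp add: fps_conv_radius_def)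
  qed
  obtain r :: real where r: "0 < r" "ereal r < fps_conv_radius A"
    using ereal_dense2[OF pos] by (auto simp: zero_ereal_def)
  have "\<forall>\<^sub>F h::real in nhds 0. eval_fps A (of_real h) = g (of_real h)"
  proof -
    have "filterlim (of_real :: real \<Rightarrow> complex) (nhds 0) (nhds 0)"
      using tendsto_of_real[OF filterlim_ident[of "nhds (0::real)"]] by simp
    from filterlim_iff[THEN iffD1, OF this] ev show ?thesis by blast
  qed
  moreover have "\<forall>\<^sub>F h::real in nhds 0. norm h < r"
    using r(1) by (auto simp: eventually_nhds_metric)
  ultimately have "\<forall>\<^sub>F h::real in nhds 0. eval_fps ?R h = Re (g (of_real h))"
  proof eventually_elim
    case (elim h)
    then have "ereal (norm h) < fps_conv_radius A" using r(2) by (meson ereal_less_eq(3) le_less_trans less_imp_le)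
    from sums_unique[OF sums[OF this]] elim show ?case by (simp add: eval_fps_def)
  qed
  then show ?thesis using pos rad by (auto simp: has_fps_expansion_def)
qed

text \<open>Locally \<open>ln (norm (E z))\<close> is the real part of a holomorphic logarithm of
  \<open>E\<close>.\<close>

lemma real_analytic_on_ln_norm:
  assumes E: "E holomorphic_on T" and T: "open T" "of_real a \<in> T" and nz: "E (of_real a) \<noteq> 0"
  shows "\<exists>F. (\<lambda>h::real. ln (norm (E (of_real (a + h))))) has_fps_expansion F"
proof -
  \<comment> \<open>Dividing by \<open>c\<close> makes the quotient 1 at \<open>a\<close>, away from
    the branch cut of \<open>Ln\<close>; \<open>ln (norm c)\<close> is added back
    afterwards.\<close>
  define c where "c = E (of_real a)"
  have ana: "E analytic_on {of_real a}" using E T by (auto simp: analytic_at)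
  have "(\<lambda>z. Ln (E z / c)) analytic_on {of_real a}"
    using nz ana by (intro analytic_intros) (auto simp: c_def)
  from analytic_at_imp_has_fps_expansion[OF this]
  obtain A where "(\<lambda>x. Ln (E (of_real a + x) / c)) has_fps_expansion A" by blast
  from fps_expansion_Re[OF this]
  have "(\<lambda>h::real. ln (norm c) + Re (Ln (E (of_real a + of_real h) / c)))
      has_fps_expansion (fps_const (ln (norm c)) + Abs_fps (\<lambda>n. Re (fps_nth A n)))"
    by (intro has_fps_expansion_add has_fps_expansion_const)
  moreover have "\<forall>\<^sub>F h::real in nhds 0. ln (norm c) + Re (Ln (E (of_real a + of_real h) / c))
      = ln (norm (E (of_real (a + h))))"
  proof -
    have "isCont E (of_real a)" using ana analytic_at_imp_isCont by blast
    moreover have "filterlim (\<lambda>h::real. of_real (a + h) :: complex) (nhds (of_real a)) (nhds 0)"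
      using tendsto_of_real[OF tendsto_add[OF tendsto_const filterlim_ident[of "nhds (0::real)"]], of a] by simp
    ultimately have "((\<lambda>h::real. E (of_real (a + h))) \<longlongrightarrow> c) (nhds 0)"
      unfolding c_def by (rule isCont_tendsto_compose)
    then have "\<forall>\<^sub>F h::real in nhds 0. E (of_real (a + h)) \<noteq> 0"
      using nz by (intro tendsto_imp_eventually_ne) (auto simp: c_def)
    then show ?thesis
    proof eventually_elim
      case (elim h)
      then show ?case using nz by (simp add: c_def norm_divide ln_div)
    qed
  qed
  ultimately show ?thesis
    using has_fps_expansion_cong[OF _ refl] by fast
qed

text \<open>H. H. Rugh's complexification of the cone of nonnegative vectors.\<close>

definition complex_cone :: "'i set \<Rightarrow> ('i \<Rightarrow> complex) set" where
  "complex_cone I = {u. (\<forall>i\<in>I. \<forall>j\<in>I. 0 \<le> Re (u i * cnj (u j))) \<and> (\<exists>i\<in>I. u i \<noteq> 0)}"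

lemma sum_norm_squares_pos:
  assumes "finite I" "u \<in> complex_cone I"
  shows "0 < (\<Sum>i\<in>I. (norm (u i))\<^sup>2)"
proof -
  obtain i where "i \<in> I" "u i \<noteq> 0" using assms by (auto simp: complex_cone_def)
  then show ?thesis using assms(1) by (intro sum_pos2[of _ i]) auto
qed

text \<open>The squared modulus of the sum is the double sum of \<open>Re (u i * cnj (u j))\<close>,
  which dominates its positive diagonal.\<close>

lemma sum_complex_cone_nonzero:
  assumes I: "finite I" and u: "u \<in> complex_cone I"
  shows "(\<Sum>i\<in>I. u i) \<noteq> 0"
proof
  assume 0: "(\<Sum>i\<in>I. u i) = 0"
  have "(\<Sum>i\<in>I. (norm (u i))\<^sup>2) \<le> (\<Sum>i\<in>I. \<Sum>j\<in>I. Re (u i * cnj (u j)))"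
  proof (rule sum_mono)
    fix i assume i: "i \<in> I"
    have "Re (u i * cnj (u i)) \<le> (\<Sum>j\<in>I. Re (u i * cnj (u j)))"
      using u i I by (intro member_le_sum) (auto simp: complex_cone_def)
    then show "(norm (u i))\<^sup>2 \<le> (\<Sum>j\<in>I. Re (u i * cnj (u j)))"
      by (simp add: complex_norm_square[symmetric] flip: of_real_power)
  qed
  also have "\<dots> = Re ((\<Sum>i\<in>I. u i) * cnj (\<Sum>j\<in>I. u j))"
    by (simp add: cnj_sum sum_product del: Re_sum) (simp add: Re_sum)
  finally show False using 0 sum_norm_squares_pos[OF I u] by simp
qed

text \<open>Expand the product of one image entry with the conjugate of another as a double sum. The
  real approximations \<open>r\<close> of the coefficients contribute at least
  \<open>\<alpha>\<close> times the sum of squares; the errors, by the inequality of means, cost at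
  most \<open>\<eta> * card I\<close> times it.\<close>

lemma complex_cone_invariant:
  assumes I: "finite I" "I \<noteq> {}"
    and A: "\<And>i j k l. \<lbrakk>i \<in> I; j \<in> I; k \<in> I; l \<in> I\<rbrakk> \<Longrightarrow>
        \<exists>r::real. \<alpha> \<le> r \<and> norm (A i k * cnj (A j l) - of_real r) \<le> \<eta>"
    and \<alpha>: "0 \<le> \<eta>" "\<eta> * card I < \<alpha>"
    and u: "u \<in> complex_cone I"
  shows "(\<lambda>i. \<Sum>k\<in>I. A i k * u k) \<in> complex_cone I"
proof -
  let ?v = "\<lambda>i. \<Sum>k\<in>I. A i k * u k" and ?Q = "\<Sum>k\<in>I. (norm (u k))\<^sup>2"
  have Q: "0 < ?Q" using sum_norm_squares_pos[OF I(1) u] .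
  have \<alpha>0: "0 \<le> \<alpha>" using \<alpha> by (meson less_imp_le mult_nonneg_nonneg of_nat_0_le_iff order_trans)
  have *: "0 < Re (?v i * cnj (?v j))" if ij: "i \<in> I" "j \<in> I" for i j
  proof -
    have entry: "\<alpha> * (if k = l then (norm (u k))\<^sup>2 else 0) - \<eta> * (((norm (u k))\<^sup>2 + (norm (u l))\<^sup>2) / 2)
        \<le> Re (A i k * u k * cnj (A j l * u l))" if kl: "k \<in> I" "l \<in> I" for k l
    proof -
      obtain r where r: "\<alpha> \<le> r" "norm (A i k * cnj (A j l) - of_real r) \<le> \<eta>" using A[OF ij kl] by blast
      let ?d = "A i k * cnj (A j l) - of_real r"
      have "0 \<le> Re (u k * cnj (u l))" using u kl by (auto simp: complex_cone_def)
      moreover have "(norm (u k))\<^sup>2 = Re (u k * cnj (u l))" if "k = l"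
        using that by (simp add: complex_norm_square[symmetric] flip: of_real_power)
      ultimately have 1: "\<alpha> * (if k = l then (norm (u k))\<^sup>2 else 0) \<le> r * Re (u k * cnj (u l))"
        using r(1) \<alpha>0 by (auto intro!: mult_right_mono mult_nonneg_nonneg)
      have "norm (?d * (u k * cnj (u l))) \<le> \<eta> * (norm (u k) * norm (u l))"
        unfolding norm_mult complex_mod_cnj using r(2) by (intro mult_right_mono) auto
      also have "\<dots> \<le> \<eta> * (((norm (u k))\<^sup>2 + (norm (u l))\<^sup>2) / 2)"
        using sum_squares_bound[of "norm (u k)" "norm (u l)"] \<alpha>(1) by (intro mult_left_mono) auto
      finally have "- (\<eta> * (((norm (u k))\<^sup>2 + (norm (u l))\<^sup>2) / 2)) \<le> Re (?d * (u k * cnj (u l)))"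
        using abs_Re_le_cmod[of "?d * (u k * cnj (u l))"] by linarith
      moreover have Re_of_real_mult: "Re (of_real r * w) = r * Re w" for w by simp
      have "A i k * u k * cnj (A j l * u l) = of_real r * (u k * cnj (u l)) + ?d * (u k * cnj (u l))"
        by (simp add: algebra_simps)
      then have "Re (A i k * u k * cnj (A j l * u l)) = r * Re (u k * cnj (u l)) + Re (?d * (u k * cnj (u l)))"
        by (simp only: plus_complex.sel Re_of_real_mult)
      ultimately show ?thesis using 1 by linarith
    qed
    have "(\<Sum>k\<in>I. \<Sum>l\<in>I. \<alpha> * (if k = l then (norm (u k))\<^sup>2 else 0)) = \<alpha> * ?Q"
      using I(1) by (simp add: sum_distrib_left if_distrib cong: if_cong)
    moreover have "(\<Sum>k\<in>I. \<Sum>l\<in>I. \<eta> * (((norm (u k))\<^sup>2 + (norm (u l))\<^sup>2) / 2)) = \<eta> * (card I * ?Q)"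
    proof -
      have "(\<Sum>k\<in>I. \<Sum>l\<in>I. ((norm (u k))\<^sup>2 + (norm (u l))\<^sup>2) / 2) = card I * ?Q"
        by (simp add: add_divide_distrib sum.distrib sum_distrib_left[symmetric] sum_divide_distrib[symmetric])
      then show ?thesis unfolding sum_distrib_left[symmetric] by (rule arg_cong)
    qed
    ultimately have "\<alpha> * ?Q - \<eta> * (card I * ?Q) = (\<Sum>k\<in>I. \<Sum>l\<in>I. \<alpha> * (if k = l then (norm (u k))\<^sup>2 else 0)
        - \<eta> * (((norm (u k))\<^sup>2 + (norm (u l))\<^sup>2) / 2))"
      by (simp only: sum_subtractf)
    also have "\<dots> \<le> (\<Sum>k\<in>I. \<Sum>l\<in>I. Re (A i k * u k * cnj (A j l * u l)))"
      by (intro sum_mono entry)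
    also have "\<dots> = Re (?v i * cnj (?v j))"
      unfolding cnj_sum sum_product Re_sum ..
    finally have "(\<alpha> - \<eta> * card I) * ?Q \<le> Re (?v i * cnj (?v j))" by (simp add: algebra_simps)
    moreover have "0 < (\<alpha> - \<eta> * card I) * ?Q" using Q \<alpha>(2) by simp
    ultimately show ?thesis by linarith
  qed
  obtain i where i: "i \<in> I" using I by blast
  have "?v i \<noteq> 0" using *[OF i i] by (metis less_irrefl mult_zero_left zero_complex.sel(1))
  then show ?thesis unfolding complex_cone_def mem_Collect_eq using *[THEN less_imp_le] i by blast
qed

text \<open>Entry \<open>i\<close> of a product of \<open>m\<close> matrices with entries
  \<open>exp (z * F n i k)\<close> applied to the vector of ones; the recursion removes the leftmost
  matrix and shifts \<open>F\<close>. The type variable lets one definition serve real and complex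
  parameters.\<close>

primrec transfer_product :: "'i set \<Rightarrow> nat \<Rightarrow> (nat \<Rightarrow> 'i \<Rightarrow> 'i \<Rightarrow> real) \<Rightarrow> 'i \<Rightarrow> 'a \<Rightarrow> 'a::{real_normed_field, banach}" where
  "transfer_product I 0 F i z = 1"
| "transfer_product I (Suc m) F i z =
     (\<Sum>k\<in>I. exp (z * of_real (F 0 i k)) * transfer_product I m (\<lambda>n. F (Suc n)) k z)"

lemma transfer_product_of_real:
  "transfer_product I m F i (of_real t :: complex) = of_real (transfer_product I m F i t)"
  by (induction m arbitrary: F i) (simp_all add: exp_of_real[symmetric] del: exp_of_real)

lemma transfer_product_pos:
  "finite I \<Longrightarrow> I \<noteq> {} \<Longrightarrow> 0 < transfer_product I m F i (t::real)"
  by (induction m arbitrary: F i) (auto intro!: sum_pos)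

lemma transfer_product_holomorphic:
  "(\<lambda>z. transfer_product I m F i z) holomorphic_on T"
  by (induction m arbitrary: F i) (simp_all add: transfer_product.simps[abs_def] holomorphic_intros)

text \<open>Growth is at most geometric in \<open>m\<close>, so the \<open>m\<close>-th roots stay
  bounded.\<close>

lemma norm_transfer_product_le:
  fixes z :: complex
  assumes D: "\<And>m i k. \<bar>F m i k\<bar> \<le> D" and z: "norm z \<le> K"
  shows "norm (transfer_product I m F i z) \<le> (card I * exp (K * D)) ^ m"
  using D
proof (induction m arbitrary: F i)
  case (Suc m)
  have D0: "0 \<le> D" using Suc.prems[of 0 i i] by simp
  have "norm (exp (z * of_real (F 0 i k)) * transfer_product I m (\<lambda>n. F (Suc n)) k z)
      \<le> exp (K * D) * (card I * exp (K * D)) ^ m" for k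
  proof -
    have "norm (z * of_real (F 0 i k)) \<le> K * D"
      unfolding norm_mult using z Suc.prems[of 0 i k] order_trans[OF norm_ge_zero z]
      by (intro mult_mono) auto
    then have "norm (exp (z * of_real (F 0 i k))) \<le> exp (K * D)"
      by (intro order_trans[OF norm_exp]) simp
    then show ?thesis unfolding norm_mult using Suc.IH[OF Suc.prems] by (intro mult_mono) auto
  qed
  then have "(\<Sum>k\<in>I. norm (exp (z * of_real (F 0 i k)) * transfer_product I m (\<lambda>n. F (Suc n)) k z))
      \<le> (\<Sum>k\<in>I. exp (K * D) * (card I * exp (K * D)) ^ m)"
    by (intro sum_mono)
  then show ?case by (auto intro: order_trans[OF norm_sum])
qed simp

text \<open>A matrix entry times the conjugate of another is a real exponential between
  \<open>1 / \<rho>\<close> and \<open>\<rho>\<close>, times a factor near 1. Hence every single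
  matrix preserves the cone, and \<open>\<delta>\<close> depends on neither \<open>m\<close> nor
  \<open>F\<close>: perturbations do not accumulate.\<close>

lemma transfer_product_in_cone:
  assumes I: "finite I" "I \<noteq> {}"
  shows "\<exists>\<delta>>0. \<forall>z F m. norm (z - of_real a) < \<delta> \<longrightarrow> (\<forall>m i k. \<bar>F m i k\<bar> \<le> D)
    \<longrightarrow> (\<lambda>i. transfer_product I m F i z) \<in> complex_cone I"
proof -
  define \<rho> where "\<rho> = exp (2 * \<bar>a\<bar> * \<bar>D\<bar>)"
  \<comment> \<open>Chosen so that \<open>\<rho> * \<kappa> * card I\<close> is half of
    \<open>1 / \<rho>\<close>.\<close>
  define \<kappa> where "\<kappa> = 1 / (\<rho> * \<rho> * (2 * card I))"
  have \<rho>: "0 < \<rho>" by (simp add: \<rho>_def)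
  have card: "0 < real (card I)" using I by (simp add: card_gt_0_iff)
  have \<kappa>: "0 < \<kappa>" using \<rho> card by (simp add: \<kappa>_def)
  have "isCont exp (0::complex)" by simp
  then obtain s where s: "0 < s" "\<And>z::complex. norm z < s \<Longrightarrow> norm (exp z - 1) < \<kappa>"
    using \<kappa> unfolding continuous_at_eps_delta dist_norm by (metis diff_zero exp_zero)
  \<comment> \<open>The deviation \<open>e\<close> below has modulus at most
    \<open>2 * \<delta> * \<bar>D\<bar>\<close>; the added 1 keeps the denominator positive.\<close>
  define \<delta> where "\<delta> = s / (2 * \<bar>D\<bar> + 1)"
  have \<delta>: "0 < \<delta>" using s by (simp add: \<delta>_def)
  have "(\<lambda>i. transfer_product I m F i z) \<in> complex_cone I"
    if z: "norm (z - of_real a) < \<delta>" and F: "\<And>m i k. \<bar>F m i k\<bar> \<le> D" for z F m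
    using F
  proof (induction m arbitrary: F)
    case 0
    show ?case using I by (auto simp: complex_cone_def)
  next
    case (Suc m)
    let ?A = "\<lambda>i k. exp (z * of_real (F 0 i k))"
    have "(\<lambda>i. \<Sum>k\<in>I. ?A i k * transfer_product I m (\<lambda>n. F (Suc n)) k z) \<in> complex_cone I"
    proof (rule complex_cone_invariant[OF I, where \<alpha> = "1 / \<rho>" and \<eta> = "\<rho> * \<kappa>"])
      fix i j k l
      let ?x = "F 0 i k" and ?y = "F 0 j l"
      have xy: "\<bar>?x\<bar> \<le> \<bar>D\<bar>" "\<bar>?y\<bar> \<le> \<bar>D\<bar>" using Suc.prems abs_ge_self order_trans by blast+
      define r where "r = exp (a * (?x + ?y))"
      have "\<bar>a * (?x + ?y)\<bar> \<le> \<bar>a\<bar> * (2 * \<bar>D\<bar>)"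
        unfolding abs_mult using xy by (intro mult_left_mono) auto
      then have r: "1 / \<rho> \<le> r" "r \<le> \<rho>"
        by (auto simp: r_def \<rho>_def exp_minus[symmetric] inverse_eq_divide[symmetric] abs_le_iff algebra_simps)
      define e where "e = (z - of_real a) * of_real ?x + cnj (z - of_real a) * of_real ?y"
      have "norm e \<le> \<delta> * \<bar>D\<bar> + \<delta> * \<bar>D\<bar>"
        unfolding e_def using xy z \<delta>
        by (intro norm_triangle_le add_mono) (auto simp: norm_mult simp flip: complex_cnj_diff intro!: mult_mono)
      also have "\<dots> < s"
      proof -
        have "\<delta> * (2 * \<bar>D\<bar> + 1) = s" by (simp add: \<delta>_def)
        then show ?thesis using \<delta> by (simp add: algebra_simps)
      qed
      finally have e: "norm (exp e - 1) \<le> \<kappa>" using s(2) by (simp add: less_imp_le)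
      have "?A i k * cnj (?A j l) = of_real r * exp e"
      proof -
        have "cnj (?A j l) = exp (cnj z * of_real ?y)" by (simp add: exp_cnj)
        then have "?A i k * cnj (?A j l) = exp (z * of_real ?x + cnj z * of_real ?y)"
          by (simp add: exp_add)
        also have "z * of_real ?x + cnj z * of_real ?y = of_real (a * (?x + ?y)) + e"
          by (simp add: e_def algebra_simps)
        finally show ?thesis by (simp only: exp_add exp_of_real r_def)
      qed
      then have "?A i k * cnj (?A j l) - of_real r = of_real r * (exp e - 1)"
        by (simp add: right_diff_distrib)
      then have "norm (?A i k * cnj (?A j l) - of_real r) = r * norm (exp e - 1)"
        by (simp add: norm_mult r_def)
      also have "\<dots> \<le> \<rho> * \<kappa>" using r e \<rho> by (intro mult_mono) auto
      finally show "\<exists>r::real. 1 / \<rho> \<le> r \<and> norm (?A i k * cnj (?A j l) - of_real r) \<le> \<rho> * \<kappa>"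
        using r by blast
    next
      show "0 \<le> \<rho> * \<kappa>" using \<rho> \<kappa> by simp
      show "\<rho> * \<kappa> * card I < 1 / \<rho>" using \<rho> card by (simp add: \<kappa>_def field_simps)
      show "(\<lambda>i. transfer_product I m (\<lambda>n. F (Suc n)) i z) \<in> complex_cone I"
        by (rule Suc.IH) (rule Suc.prems)
    qed
    then show ?case by simp
  qed
  then show ?thesis using \<delta> by blast
qed

text \<open>The \<open>m\<close>-th roots of the partition functions are zero-free and bounded on a complex disc, so
  Montel's theorem gives a holomorphic limit whose modulus on the real axis is \<open>exp \<psi>\<close>.\<close>

lemma transfer_product_growth_analytic:
  assumes I: "finite I" "I \<noteq> {}" and F: "\<And>m i k. \<bar>F m i k\<bar> \<le> D"
    and lim: "\<And>t. (\<lambda>m. ln (\<Sum>i\<in>I. transfer_product I m F i t) / real m) \<longlonglongrightarrow> \<psi> t"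
  shows "real_analytic_on \<psi> UNIV"
  unfolding real_analytic_on_def
proof
  fix a :: real
  obtain \<delta> where \<delta>: "0 < \<delta>" and cone: "\<And>z m. norm (z - of_real a) < \<delta> \<Longrightarrow>
      (\<lambda>i. transfer_product I m F i z) \<in> complex_cone I"
    using transfer_product_in_cone[OF I, of a D] F by metis
  define T where "T = ball (complex_of_real a) \<delta>"
  define G where "G m z = (\<Sum>i\<in>I. transfer_product I m F i z)" for m and z :: complex
  have inT: "norm (z - of_real a) < \<delta>" if "z \<in> T" for z
    using that by (simp add: T_def dist_norm norm_minus_commute)
  have G0: "G m z \<noteq> 0" if "z \<in> T" for m z
    unfolding G_def using cone[OF inT[OF that]] by (rule sum_complex_cone_nonzero[OF I(1)])
  \<comment> \<open>A zero-free holomorphic function on the contractible disc has a holomorphic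
    logarithm, which defines the \<open>m\<close>-th roots.\<close>
  have "\<exists>g. g holomorphic_on T \<and> (\<forall>z\<in>T. G m z = exp (g z))" for m
  proof -
    have "G m holomorphic_on T" unfolding G_def[abs_def]
      by (intro holomorphic_intros transfer_product_holomorphic)
    moreover have "contractible T" unfolding T_def by (intro convex_imp_contractible convex_ball)
    ultimately show ?thesis using contractible_imp_holomorphic_log[of "G m" T] G0 by metis
  qed
  then obtain g where g: "\<And>m. g m holomorphic_on T" and Gg: "\<And>m z. z \<in> T \<Longrightarrow> G m z = exp (g m z)"
    by metis
  define E where "E m z = exp (g m z / of_nat m)" for m z
  have E_norm: "norm (E m z) = exp (ln (norm (G m z)) / real m)" if "z \<in> T" for m z
    using that by (simp add: E_def Gg)
  \<comment> \<open>The sum over \<open>I\<close> adds a factor \<open>card I\<close>, which is at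
    most \<open>card I ^ m\<close> for positive \<open>m\<close>.\<close>
  define L where "L = real (card I) * (real (card I) * exp ((\<bar>a\<bar> + \<delta>) * D))"
  \<comment> \<open>The absolute value makes \<open>M\<close> at least 1, covering
    \<open>m = 0\<close>, where division by zero gives \<open>E 0 z = 1\<close>.\<close>
  define M where "M = exp (\<bar>ln L\<bar>)"
  have card: "1 \<le> real (card I)" using I by (simp add: Suc_leI card_gt_0_iff)
  have L: "0 < L" using card by (simp add: L_def)
  have E_bound: "norm (E m z) \<le> M" if z: "z \<in> T" for m z
  proof (cases "m = 0")
    case False
    have nz: "norm z \<le> \<bar>a\<bar> + \<delta>"
      using inT[OF z] norm_triangle_ineq2[of z "of_real a"] by simp
    have "norm (G m z) \<le> (\<Sum>i\<in>I. (card I * exp ((\<bar>a\<bar> + \<delta>) * D)) ^ m)"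
      unfolding G_def by (intro order_trans[OF norm_sum] sum_mono norm_transfer_product_le F nz)
    also have "\<dots> = card I * (card I * exp ((\<bar>a\<bar> + \<delta>) * D)) ^ m" by simp
    also have "\<dots> \<le> real (card I) ^ m * (card I * exp ((\<bar>a\<bar> + \<delta>) * D)) ^ m"
      by (rule mult_right_mono[OF self_le_power]) (use card False in simp_all)
    also have "\<dots> = L ^ m" by (simp add: L_def power_mult_distrib)
    finally have "ln (norm (G m z)) \<le> ln (L ^ m)" using G0[OF z] by (intro ln_mono) auto
    also have "\<dots> = real m * ln L" using L by (simp add: ln_realpow)
    also have "\<dots> \<le> real m * \<bar>ln L\<bar>" by (intro mult_left_mono) auto
    finally show ?thesis using False by (simp add: E_norm[OF z] M_def divide_le_eq ac_simps)
  qed (simp add: E_def M_def)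
  obtain h r where h: "h holomorphic_on T" and r: "strict_mono (r :: nat \<Rightarrow> nat)"
    and hlim: "\<And>z. z \<in> T \<Longrightarrow> (\<lambda>n. E (r n) z) \<longlonglongrightarrow> h z"
  proof (rule Montel[of T "range E" E])
    show "open T" by (simp add: T_def)
    show "k holomorphic_on T" if k: "k \<in> range E" for k
    proof -
      obtain m where "k = E m" using k by blast
      then show ?thesis unfolding E_def[abs_def] divide_inverse
        by (auto intro!: holomorphic_intros g)
    qed
    show "\<exists>B. \<forall>k\<in>range E. \<forall>z\<in>K. norm (k z) \<le> B" if "K \<subseteq> T" for K
      using E_bound that by blast
  qed auto
  \<comment> \<open>On the real axis the full sequence of moduli converges, so the subsequence from
    Montel's theorem already identifies the modulus of \<open>h\<close>.\<close>
  have norm_h: "norm (h (of_real t)) = exp (\<psi> t)" if t: "of_real t \<in> T" for t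
  proof (rule LIMSEQ_unique)
    show "(\<lambda>n. norm (E (r n) (of_real t))) \<longlonglongrightarrow> norm (h (of_real t))"
      by (intro tendsto_norm hlim t)
    have "norm (G m (of_real t)) = (\<Sum>i\<in>I. transfer_product I m F i t)" for m
      using transfer_product_pos[OF I] unfolding G_def transfer_product_of_real of_real_sum[symmetric] norm_of_real
      by (simp add: sum_nonneg less_imp_le)
    then have "norm (E m (of_real t)) = exp (ln (\<Sum>i\<in>I. transfer_product I m F i t) / real m)" for m
      by (simp add: E_norm[OF t])
    then show "(\<lambda>n. norm (E (r n) (of_real t))) \<longlonglongrightarrow> exp (\<psi> t)"
      using LIMSEQ_subseq_LIMSEQ[OF tendsto_exp[OF lim[of t]] r] by (simp add: comp_def)
  qed
  have aT: "of_real a \<in> T" using \<delta> by (simp add: T_def)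
  have "h (of_real a) \<noteq> 0" using norm_h[OF aT] by (metis exp_not_eq_zero norm_zero)
  then obtain A where A: "(\<lambda>t::real. ln (norm (h (of_real (a + t))))) has_fps_expansion A"
    using real_analytic_on_ln_norm[OF h _ aT] by (auto simp: T_def)
  have "\<forall>\<^sub>F t::real in nhds 0. \<psi> (a + t) = ln (norm (h (of_real (a + t))))"
  proof -
    have "\<forall>\<^sub>F t::real in nhds 0. norm t < \<delta>" using \<delta> by (auto simp: eventually_nhds_metric)
    then show ?thesis
    proof eventually_elim
      case (elim t)
      then have "of_real (a + t) \<in> T" by (simp add: T_def dist_norm)
      then show ?case using norm_h[of "a + t"] by simp
    qed
  qed
  from has_fps_expansion_cong[THEN iffD2, OF this refl A]
  show "\<exists>A. (\<lambda>t. \<psi> (a + t)) has_fps_expansion A" by blast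
qed

section \<open>Blocks of coordinates\<close>

context bernoulli_potential
begin

text \<open>If \<open>f\<close> depends on the first \<open>d\<close> coordinates, the energy
  collected in block \<open>m\<close> involves only that block \<open>c\<close> and the next one
  \<open>c'\<close>. The value 0 outside \<open>seqs S\<close> makes the bound hold for all
  arguments, as the results on matrix products require.\<close>

definition block_energy :: "nat \<Rightarrow> (nat \<Rightarrow> real) \<Rightarrow> nat \<Rightarrow> (nat \<Rightarrow> 's) \<Rightarrow> (nat \<Rightarrow> 's) \<Rightarrow> real" where
  "block_energy d w m c c' =
    (if c \<in> seqs S \<and> c' \<in> seqs S then energy f ((left_shift ^^ (m * d)) w) d (comb_seq d c c') else 0)"

lemma block_energy_Suc: "block_energy d w (Suc m) = block_energy d ((left_shift ^^ d) w) m"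
proof -
  have "(left_shift ^^ (Suc m * d)) w = (left_shift ^^ (m * d)) ((left_shift ^^ d) w)"
    by (simp add: funpow_left_shift ac_simps)
  then show ?thesis unfolding block_energy_def by presburger
qed

lemma abs_block_energy_le:
  assumes "w \<in> bounded_weights B"
  shows "\<bar>block_energy d w m c c'\<bar> \<le> real d * (B * f_bound)"
proof (cases "c \<in> seqs S \<and> c' \<in> seqs S")
  case True
  have "(left_shift ^^ (m * d)) w \<in> bounded_weights B" using assms by (rule bounded_weights_shift)
  from abs_energy_le[OF bounded_weightsD[OF this], where x = "comb_seq d c c'" and n = d] True show ?thesis
    by (simp add: block_energy_def seqs_comb_seq)
next
  case False
  then show ?thesis
    using bounded_weights_nonneg[OF assms] f_bound_nonneg by (auto simp: block_energy_def)
qed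

lemma comb_seq_word_measurable:
  assumes "c \<in> seqs S"
  shows "(\<lambda>y. comb_seq n c y) \<in> measurable (bernoulli S) (bernoulli S)"
proof -
  have "(\<lambda>y. (c, y)) \<in> measurable (bernoulli S) (bernoulli S \<Otimes>\<^sub>M bernoulli S)"
    using assms by (intro measurable_Pair1') (simp add: space_bernoulli)
  from measurable_compose[OF this comb_seq_measurable] show ?thesis by simp
qed

section \<open>The partition function as a matrix product\<close>

context
  fixes B :: real and d :: nat
  assumes dep: "\<And>x y. x \<in> seqs S \<Longrightarrow> y \<in> seqs S \<Longrightarrow> (\<And>k. k < d \<Longrightarrow> x k = y k) \<Longrightarrow> f x = f y"
begin

lemma energy_eq_if_agree:
  assumes "x \<in> seqs S" "y \<in> seqs S" "\<And>k. k < n + d \<Longrightarrow> x k = y k"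
  shows "energy f w n x = energy f w n y"
  unfolding energy_def
proof (rule sum.cong)
  fix k assume "k \<in> {..<n}"
  then have "f ((left_shift ^^ k) x) = f ((left_shift ^^ k) y)"
    using assms by (intro dep seqs_funpow_left_shift) (auto simp: funpow_left_shift)
  then show "w k * f ((left_shift ^^ k) x) = w k * f ((left_shift ^^ k) y)" by simp
qed simp

text \<open>The integral is the partition function conditioned on the first block being
  \<open>c\<close>. Averaging over the next block with \<open>integral_split_word\<close> removes
  one matrix, matching the recursion of \<open>transfer_product\<close>.\<close>

lemma word_partition_fn:
  assumes "w \<in> bounded_weights B" "c \<in> seqs S"
  shows "(\<integral>y. exp (t * energy f w (m * d) (comb_seq d c y)) \<partial>bernoulli S)
    = transfer_product (words d) m (block_energy d w) c t / real (card S) ^ (d * m)"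
  using assms
proof (induction m arbitrary: w c)
  case 0
  show ?case by (simp add: energy_def B.prob_space)
next
  case (Suc m)
  let ?w = "(left_shift ^^ d) w"
  have w': "?w \<in> bounded_weights B" using Suc.prems(1) by (rule bounded_weights_shift)
  let ?G = "\<lambda>y. exp (t * energy f w (Suc m * d) (comb_seq d c y))"
  have split: "?G (comb_seq d c' y) = exp (t * block_energy d w 0 c c') * exp (t * energy f ?w (m * d) (comb_seq d c' y))"
    if c': "c' \<in> seqs S" and y: "y \<in> seqs S" for c' y
  proof -
    have "energy f w (d + m * d) (comb_seq d c (comb_seq d c' y))
        = energy f w d (comb_seq d c (comb_seq d c' y)) + energy f ?w (m * d) (comb_seq d c' y)"
      by (simp add: energy_add left_shift_comb_seq)
    \<comment> \<open>The first \<open>d\<close> energy terms read only coordinates below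
      \<open>2 * d\<close>, so the tail \<open>y\<close> drops out.\<close>
    also have "energy f w d (comb_seq d c (comb_seq d c' y)) = energy f w d (comb_seq d c c')"
      using Suc.prems(2) c' y by (intro energy_eq_if_agree seqs_comb_seq) (auto simp: comb_seq_def)
    also have "\<dots> = block_energy d w 0 c c'" using Suc.prems(2) c' by (simp add: block_energy_def)
    finally show ?thesis by (simp add: exp_add distrib_left)
  qed
  have "(\<integral>y. ?G y \<partial>bernoulli S) = (\<Sum>c'\<in>words d. \<integral>y. ?G (comb_seq d c' y) \<partial>bernoulli S) / real (card S) ^ d"
    by (rule integral_split_word) (rule exp_energy_comp_integrable[OF Suc.prems(1) comb_seq_word_measurable[OF Suc.prems(2)]])
  also have "(\<Sum>c'\<in>words d. \<integral>y. ?G (comb_seq d c' y) \<partial>bernoulli S)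
      = (\<Sum>c'\<in>words d. exp (t * block_energy d w 0 c c') *
          (transfer_product (words d) m (block_energy d ?w) c' t / real (card S) ^ (d * m)))"
  proof (rule sum.cong[OF refl])
    fix c' assume "c' \<in> words d"
    then have c': "c' \<in> seqs S" using words_subset by blast
    have "(\<integral>y. ?G (comb_seq d c' y) \<partial>bernoulli S)
        = (\<integral>y. exp (t * block_energy d w 0 c c') * exp (t * energy f ?w (m * d) (comb_seq d c' y)) \<partial>bernoulli S)"
      by (rule Bochner_Integration.integral_cong[OF refl split[OF c']]) (simp add: space_bernoulli)
    then show "(\<integral>y. ?G (comb_seq d c' y) \<partial>bernoulli S) = exp (t * block_energy d w 0 c c') *
        (transfer_product (words d) m (block_energy d ?w) c' t / real (card S) ^ (d * m))"
      using Suc.IH[OF w' c'] by simp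
  qed
  also have "\<dots> / real (card S) ^ d
      = transfer_product (words d) (Suc m) (block_energy d w) c t / real (card S) ^ (d * Suc m)"
    by (simp add: block_energy_Suc sum_divide_distrib power_add ac_simps)
  finally show ?case .
qed

text \<open>The initial block is averaged too, hence \<open>m + 1\<close> blocks in the
  normalisation for \<open>m\<close> matrices.\<close>

lemma partition_fn_transfer_product:
  assumes w: "w \<in> bounded_weights B"
  shows "partition_fn S f (m * d) t w
    = (\<Sum>c\<in>words d. transfer_product (words d) m (block_energy d w) c t) / real (card S) ^ (d * Suc m)"
proof -
  have "partition_fn S f (m * d) t w
      = (\<Sum>c\<in>words d. \<integral>y. exp (t * energy f w (m * d) (comb_seq d c y)) \<partial>bernoulli S) / real (card S) ^ d"
    unfolding partition_fn_energy by (rule integral_split_word[OF exp_energy_integrable[OF w]])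
  also have "(\<Sum>c\<in>words d. \<integral>y. exp (t * energy f w (m * d) (comb_seq d c y)) \<partial>bernoulli S)
      = (\<Sum>c\<in>words d. transfer_product (words d) m (block_energy d w) c t / real (card S) ^ (d * m))"
    using words_subset by (intro sum.cong refl word_partition_fn[OF w]) blast
  finally show ?thesis by (simp add: sum_divide_distrib power_add ac_simps)
qed

lemma pressure_real_analytic:
  assumes w: "w \<in> typical_weights B \<beta>" and d: "0 < d"
  shows "real_analytic_on (pressure S f w) UNIV"
proof -
  note wb = typical_weightsD(1)[OF w]
  let ?q = "real (card S)" and ?F = "block_energy d w"
  \<comment> \<open>This is the growth rate of the matrix products per block; \<open>ln ?q\<close>
    undoes the normalisation by powers of \<open>card S\<close>.\<close>
  define \<psi> where "\<psi> t = real d * (pressure S f w t + ln ?q)" for t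
  have q: "0 < ?q" using finite_alphabet alphabet_nonempty by (simp add: card_gt_0_iff)
  have lim: "(\<lambda>m. ln (\<Sum>c\<in>words d. transfer_product (words d) m ?F c t) / real m) \<longlonglongrightarrow> \<psi> t" for t
  proof -
    have "(\<lambda>m. log_partition (m * d) t w / real (m * d)) \<longlonglongrightarrow> pressure S f w t"
      using LIMSEQ_subseq_LIMSEQ[OF log_partition_tendsto_pressure[OF w], of "\<lambda>m. m * d"] d
      by (simp add: comp_def strict_mono_def)
    moreover have "(\<lambda>m. real (Suc m) / real m) \<longlonglongrightarrow> 1"
      by (rule LIMSEQ_Suc_n_over_n)
    ultimately have "(\<lambda>m. real d * (log_partition (m * d) t w / real (m * d) + real (Suc m) / real m * ln ?q)) \<longlonglongrightarrow>
        real d * (pressure S f w t + 1 * ln ?q)"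
      by (intro tendsto_intros)
    moreover have "real d * (log_partition (m * d) t w / real (m * d) + real (Suc m) / real m * ln ?q)
        = ln (\<Sum>c\<in>words d. transfer_product (words d) m ?F c t) / real m" for m
    proof -
      let ?P = "\<Sum>c\<in>words d. transfer_product (words d) m ?F c t"
      have "0 < ?P"
        using transfer_product_pos[OF finite_words words_nonempty] finite_words words_nonempty by (intro sum_pos) auto
      then have "log_partition (m * d) t w = ln ?P - real (d * Suc m) * ln ?q"
        using q unfolding log_partition_def partition_fn_transfer_product[OF wb]
        by (simp add: ln_div ln_realpow)
      \<comment> \<open>For \<open>m = 0\<close> both sides are 0 because of division by
        zero.\<close>
      then show ?thesis using d by (cases "m = 0") (simp_all add: field_simps)
    qed
    ultimately show ?thesis by (simp add: \<psi>_def)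
  qed
  have "real_analytic_on \<psi> UNIV"
    by (rule transfer_product_growth_analytic[OF finite_words words_nonempty abs_block_energy_le[OF wb] lim])
  have "\<exists>A. (\<lambda>h. inverse (real d) * \<psi> (a + h) - ln ?q) has_fps_expansion A" for a
  proof -
    obtain A where "(\<lambda>h. \<psi> (a + h)) has_fps_expansion A"
      using \<open>real_analytic_on \<psi> UNIV\<close> by (auto simp: real_analytic_on_def)
    then have "(\<lambda>h. inverse (real d) * \<psi> (a + h) - ln ?q)
        has_fps_expansion (fps_const (inverse (real d)) * A - fps_const (ln ?q))"
      by (intro has_fps_expansion_diff has_fps_expansion_cmult_left has_fps_expansion_const)
    then show ?thesis by blast
  qed
  moreover have "inverse (real d) * \<psi> t - ln ?q = pressure S f w t" for t
    using d by (simp add: \<psi>_def mult.assoc[symmetric])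
  ultimately show ?thesis by (simp add: real_analytic_on_def)
qed

end

end

section \<open>Passage from the process to its law, and the conclusion\<close>

lemma process_measurable:
  fixes \<omega> :: "nat \<Rightarrow> 'w \<Rightarrow> real"
  assumes "\<And>n. \<omega> n \<in> borel_measurable M"
  shows "(\<lambda>w n. \<omega> n w) \<in> measurable M (\<Pi>\<^sub>M n\<in>UNIV. borel)"
  by (rule measurable_PiM_single') (use assms in \<open>simp_all add: space_PiM\<close>)

text \<open>Composing the process with the shift gives the shifted process, so equality of the two
  laws is invariance under \<open>left_shift\<close>, the form used by Birkhoff's theorem.\<close>

lemma process_law_stationary:
  assumes \<omega>: "\<And>n. \<omega> n \<in> borel_measurable M" and "stationary M \<omega>"
  shows "distr (process_law M \<omega>) (process_law M \<omega>) left_shift = process_law M \<omega>"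
proof -
  have "distr (process_law M \<omega>) (process_law M \<omega>) left_shift = distr (process_law M \<omega>) (\<Pi>\<^sub>M n\<in>UNIV. borel) left_shift"
    by (rule distr_cong) (simp_all add: process_law_def)
  also have "\<dots> = process_law M (\<lambda>n. \<omega> (Suc n))"
    unfolding process_law_def distr_distr[OF left_shift_measurable process_measurable[OF \<omega>]] by (simp add: comp_def left_shift_def)
  finally show ?thesis using assms(2) by (simp add: stationary_def)
qed

lemma AE_uniformly_bounded:
  fixes \<omega> :: "nat \<Rightarrow> 'w \<Rightarrow> real"
  assumes "(SUP n. esssup M (\<lambda>w. ereal \<bar>\<omega> n w\<bar>)) < \<infinity>"
  shows "\<exists>B. AE w in M. \<forall>n. \<bar>\<omega> n w\<bar> \<le> B"
proof -
  obtain B where B: "(SUP n. esssup M (\<lambda>w. ereal \<bar>\<omega> n w\<bar>)) \<le> ereal B"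
    using assms by (cases "SUP n. esssup M (\<lambda>w. ereal \<bar>\<omega> n w\<bar>)") auto
  have "AE w in M. \<forall>n. ereal \<bar>\<omega> n w\<bar> \<le> esssup M (\<lambda>w. ereal \<bar>\<omega> n w\<bar>)"
    unfolding AE_all_countable by (intro allI esssup_AE)
  then have "AE w in M. \<forall>n. \<bar>\<omega> n w\<bar> \<le> B"
  proof eventually_elim
    case (elim w)
    show ?case
    proof
      fix n
      have "ereal \<bar>\<omega> n w\<bar> \<le> esssup M (\<lambda>w. ereal \<bar>\<omega> n w\<bar>)" using elim by blast
      also have "\<dots> \<le> (SUP n. esssup M (\<lambda>w. ereal \<bar>\<omega> n w\<bar>))" by (rule SUP_upper) simp
      also note B
      finally show "\<bar>\<omega> n w\<bar> \<le> B" by simp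
    qed
  qed
  then show ?thesis by (rule exI)
qed

theorem theorem1p2:
  fixes S :: "'s set"
    and M :: "'w measure"
    and \<omega> :: "nat \<Rightarrow> 'w \<Rightarrow> real"
    and f :: "(nat \<Rightarrow> 's) \<Rightarrow> real"
  assumes "finite S" and "card S \<ge> 2"
    and "prob_space M"
    and "\<And>n. \<omega> n \<in> borel_measurable M"
    and "stationary M \<omega>" and "ergodic M \<omega>"
    and "(SUP n. esssup M (\<lambda>w. ereal \<bar>\<omega> n w\<bar>)) < \<infinity>"
    and "bounded_variation S f"
  shows "(AE w in M. H1 S f (\<lambda>n. \<omega> n w) \<and> H2 S f (\<lambda>n. \<omega> n w)) \<and>
    (\<exists>\<phi>. (AE w in M. pressure S f (\<lambda>n. \<omega> n w) = \<phi>) \<and>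
         (depends_on_finitely_many_coords S f \<longrightarrow> real_analytic_on \<phi> UNIV))"
proof -
  interpret bernoulli_potential S f
    using assms(1,2,8) by unfold_locales auto
  interpret M: prob_space M by fact
  let ?P = "process_law M \<omega>"
  note X = process_measurable[of \<omega>, OF assms(4)]
  obtain B where B: "AE w in M. \<forall>n. \<bar>\<omega> n w\<bar> \<le> B"
    using AE_uniformly_bounded[OF assms(7)] by blast
  have P: "prob_space ?P" unfolding process_law_def by (rule M.prob_space_distr[OF X])
  have sets: "sets ?P = sets (\<Pi>\<^sub>M n\<in>UNIV. borel)" by (simp add: process_law_def)
  have "{w \<in> space (\<Pi>\<^sub>M n\<in>(UNIV::nat set). (borel :: real measure)). \<forall>k. \<bar>w k\<bar> \<le> B} \<in> sets (\<Pi>\<^sub>M n\<in>UNIV. borel)"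
    by measurable
  then have "AE w in ?P. w \<in> bounded_weights B"
    unfolding process_law_def bounded_weights_def mem_Collect_eq
    using B by (subst AE_distr_iff[OF X]) auto
  from AE_typical_weights[OF P sets process_law_stationary[OF assms(4,5)] _ this] assms(6)
  obtain \<beta> where "AE w in ?P. w \<in> typical_weights B \<beta>"
    by (auto simp: ergodic_def sets)
  then have good: "AE w in M. (\<lambda>n. \<omega> n w) \<in> typical_weights B \<beta>"
    unfolding process_law_def by (rule AE_distrD[OF X])
  \<comment> \<open>The pressure of one typical realization serves as the deterministic
    function.\<close>
  then obtain w0 where w0: "(\<lambda>n. \<omega> n w0) \<in> typical_weights B \<beta>"
    using eventually_happens'[OF M.ae_filter_bot] by blast
  show ?thesis
  proof (intro conjI exI[of _ "pressure S f (\<lambda>n. \<omega> n w0)"] impI)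
    show "AE w in M. H1 S f (\<lambda>n. \<omega> n w) \<and> H2 S f (\<lambda>n. \<omega> n w)"
      using good
    proof eventually_elim
      case (elim w)
      show ?case
        using H1_typical[OF elim] H2_if_bounded[OF bounded_weightsD[OF typical_weightsD(1)[OF elim]]] ..
    qed
    show "AE w in M. pressure S f (\<lambda>n. \<omega> n w) = pressure S f (\<lambda>n. \<omega> n w0)"
      using good by eventually_elim (rule pressure_typical_unique[OF _ w0])
    assume "depends_on_finitely_many_coords S f"
    then obtain J where J: "finite J \<and>
      (\<forall>x\<in>seqs S. \<forall>y\<in>seqs S. (\<forall>k\<in>J. x k = y k) \<longrightarrow> f x = f y)"
      unfolding depends_on_finitely_many_coords_def by (rule exE)
    obtain d where d: "J \<subseteq> {..<d}" using J finite_nat_bounded by blast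
    show "real_analytic_on (pressure S f (\<lambda>n. \<omega> n w0)) UNIV"
    \<comment> \<open>The successor guarantees a positive block length even when \<open>d\<close> is
      0.\<close>
    proof (rule pressure_real_analytic[where d = "Suc d", OF _ w0])
      show "0 < Suc d" by simp
      show "f x = f y" if xy: "x \<in> seqs S" "y \<in> seqs S"
        and agree: "\<And>k. k < Suc d \<Longrightarrow> x k = y k" for x y
      proof -
        have "x k = y k" if "k \<in> J" for k
          by (rule agree) (use d that in force)
        then show ?thesis using J xy by blast
      qed
    qed
  qed
qed

end
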